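(* Let $(M^{r,3-r},\phi,\xi,\eta,g)$, $r\in\{0,1\}$, be a three-dimensional pseudo-Riemannian Sasakian space-form with $\phi$-sectional curvature $H$, and let $\psi$ be a Sasakian quasi-Killing spinor (SqK-spinor) on it which is not a Killing spinor. Then the Dirac current $J_\psi$ is a Killing vector field if and only if $\psi$ satisfies $\xi\cdot\psi=\pm(-\mathrm{i})^{r-1}\psi$ (for one of the two signs). Furthermore, in this case, $\psi\in\mathcal{S}_0$ and $J_\psi$ is proportional to the Reeb vector field $\xi$.
   Context: Write $\mathrm{i}=\sqrt{-1}$; $r=0$ is the Riemannian case and $r=1$ the Lorentzian case. A Sasakian manifold is a contact metric manifold $(M,\phi,\xi,\eta,g)$ with Reeb field $\xi$, $\eta(\xi)=1$, satisfying $R(X,Y)\xi=\eta(Y)X-\eta(X)Y$; Lorentzian-Sasakian manifolds are obtained from Riemannian ones by replacing the metric $g'$ by $g'-2\eta\otimes\eta$, so $g(\xi,\xi)=(-1)^r$. The $\phi$-sectional curvature is $K(X,\phi X)$, $X\perp\xi$; a Sasakian space-form is a simply connected Sasakian manifold with constant $\phi$-sectional curvature $H$. In dimension three there is a global orthonormal frame (Sasakian frame) $e_1=\xi,e_2,e_3$, $g(e_i,e_j)=h_{ij}$, $h=\mathrm{diag}((-1)^r,1,1)$, with $[e_1,e_2]=-\frac{H+(-1)^r3}{2}e_3$, $[e_1,e_3]=\frac{H+(-1)^r3}{2}e_2$, $[e_2,e_3]=-2e_1$; the dual coframe is $\omega^1=\eta,\omega^2,\omega^3$. Indices are raised with $h$.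 Spinors: with respect to a Sasakian frame spinor fields are $\mathbb{C}^2$-valued functions, and $e_j$ acts by Clifford multiplication via $\gamma_1=(-\mathrm{i})^{r-1}\sigma_1$, $\gamma_2=\mathrm{i}\sigma_2$, $\gamma_3=\mathrm{i}\sigma_3$ ($\sigma_j$ the Pauli matrices), so $X\cdot Y+Y\cdot X=-2g(X,Y)$. The spin connection is $\nabla_X\psi=X(\psi)+\omega^S(X)\psi$ with $\omega^S=\frac{(-\mathrm{i})^r}{2}\sum_j\omega^j\gamma_j+\mathrm{i}^r\frac{H+(-1)^{r-1}}{4}\omega^1\gamma_1$. An SqK-spinor of type $(a,b)$, $a,b\in\mathbb{R}$, is a spinor field with $\nabla_X\psi=a\,\mathrm{i}^rX\cdot\psi+b\,\mathrm{i}^r\eta(X)\xi\cdot\psi$ for all $X$. A Killing spinor is a spinor field with $\nabla_X\psi=\mu X\cdot\psi$ for all $X$ and some constant $\mu$. $\mathcal{S}_0$ denotes the set of SqK-spinors of type $\left(\frac{(-1)^r}{2},\frac{H-(-1)^r}{4}\right)$. The Spin-invariant form is $\langle\psi_1,\psi_2\rangle=\psi_1^\dagger(\gamma_1)^r\psi_2$, and the Dirac current is $J_\psi=\sum_{j}(-\mathrm{i})^{r-1}\langle\psi,\gamma^j\psi\rangle e_j$. *)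

theory Defs
  imports "HOL-Analysis.Analysis"
begin

section \<open>Smooth manifolds\<close>

(* Intended for open S. *)
primrec Ck_on :: "nat \<Rightarrow> 'e::real_normed_vector set \<Rightarrow> ('e \<Rightarrow> 'f::real_normed_vector) \<Rightarrow> bool" where
  "Ck_on 0 S f = continuous_on S f"
| "Ck_on (Suc k) S f =
     ((\<forall>x\<in>S. f differentiable (at x)) \<and> (\<forall>v. Ck_on k S (\<lambda>x. frechet_derivative f (at x) v)))"

definition smooth_on :: "'e::real_normed_vector set \<Rightarrow> ('e \<Rightarrow> 'f::real_normed_vector) \<Rightarrow> bool" where
  "smooth_on S f \<longleftrightarrow> (\<forall>k. Ck_on k S f)"

type_synonym ('m, 'e) chart = "'m set \<times> ('m \<Rightarrow> 'e)"

(* The manifold is the whole type 'm. Hausdorffness and second countability are the sort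
   constraint; the manifold is smooth, modelled on the Euclidean space 'e. *)
definition smooth_atlas ::
  "('m::{t2_space, second_countable_topology}, 'e::euclidean_space) chart set \<Rightarrow> bool" where
  "smooth_atlas A \<longleftrightarrow>
     (\<Union>(U, c)\<in>A. U) = UNIV \<and>
     (\<forall>(U, c)\<in>A. open U \<and> open (c ` U) \<and> homeomorphism U (c ` U) c (inv_into U c)) \<and>
     (\<forall>(U, c)\<in>A. \<forall>(V, d)\<in>A. smooth_on (c ` (U \<inter> V)) (d \<circ> inv_into U c))"

definition smooth_fun ::
  "('m::topological_space, 'e::euclidean_space) chart set \<Rightarrow> ('m \<Rightarrow> real) \<Rightarrow> bool" where
  "smooth_fun A f \<longleftrightarrow> (\<forall>(U, c)\<in>A. smooth_on (c ` U) (f \<circ> inv_into U c))"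

section \<open>Tangent vectors and vector fields\<close>

(* A tangent vector at p is a derivation at p of the algebra of smooth functions. Its value
   on non-smooth functions is fixed to 0, so that equality of derivations is equality in HOL. *)
type_synonym 'm tvec = "('m \<Rightarrow> real) \<Rightarrow> real"
type_synonym 'm vfield = "'m \<Rightarrow> 'm tvec"

definition tangent_space ::
  "('m::topological_space, 'e::euclidean_space) chart set \<Rightarrow> 'm \<Rightarrow> 'm tvec set" where
  "tangent_space A p = {v.
     (\<forall>f g. \<forall>a b::real. smooth_fun A f \<and> smooth_fun A g \<longrightarrow>
        v (\<lambda>x. a * f x + b * g x) = a * v f + b * v g) \<and>
     (\<forall>f g. smooth_fun A f \<and> smooth_fun A g \<longrightarrow>
        v (\<lambda>x. f x * g x) = f p * v g + g p * v f) \<and>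
     (\<forall>f. \<not> smooth_fun A f \<longrightarrow> v f = 0)}"

definition tv_lin :: "real \<Rightarrow> 'm tvec \<Rightarrow> real \<Rightarrow> 'm tvec \<Rightarrow> 'm tvec" where
  "tv_lin a u b v = (\<lambda>f. a * u f + b * v f)"

definition vector_field ::
  "('m::topological_space, 'e::euclidean_space) chart set \<Rightarrow> 'm vfield \<Rightarrow> bool" where
  "vector_field A X \<longleftrightarrow>
     (\<forall>p. X p \<in> tangent_space A p) \<and> (\<forall>f. smooth_fun A f \<longrightarrow> smooth_fun A (\<lambda>p. X p f))"

definition vf_add :: "'m vfield \<Rightarrow> 'm vfield \<Rightarrow> 'm vfield" where
  "vf_add X Y = (\<lambda>p f. X p f + Y p f)"

definition vf_scale :: "('m \<Rightarrow> real) \<Rightarrow> 'm vfield \<Rightarrow> 'm vfield" where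
  "vf_scale a X = (\<lambda>p f. a p * X p f)"

definition vf_diff :: "'m vfield \<Rightarrow> 'm vfield \<Rightarrow> 'm vfield" where
  "vf_diff X Y = (\<lambda>p f. X p f - Y p f)"

definition lie_bracket :: "'m vfield \<Rightarrow> 'm vfield \<Rightarrow> 'm vfield" where
  "lie_bracket X Y = (\<lambda>p f. X p (\<lambda>q. Y q f) - Y p (\<lambda>q. X q f))"

section \<open>Tensor fields and connections\<close>

(* Tensor fields are only meaningful on tangent vectors; outside the tangent spaces their
   values are unconstrained. *)
type_synonym 'm oneform = "'m \<Rightarrow> 'm tvec \<Rightarrow> real"
type_synonym 'm bilform = "'m \<Rightarrow> 'm tvec \<Rightarrow> 'm tvec \<Rightarrow> real"
type_synonym 'm endo = "'m \<Rightarrow> 'm tvec \<Rightarrow> 'm tvec"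

definition one_form ::
  "('m::topological_space, 'e::euclidean_space) chart set \<Rightarrow> 'm oneform \<Rightarrow> bool" where
  "one_form A \<eta> \<longleftrightarrow>
     (\<forall>p. \<forall>u\<in>tangent_space A p. \<forall>v\<in>tangent_space A p. \<forall>a b.
        \<eta> p (tv_lin a u b v) = a * \<eta> p u + b * \<eta> p v) \<and>
     (\<forall>X. vector_field A X \<longrightarrow> smooth_fun A (\<lambda>p. \<eta> p (X p)))"

definition endo_field ::
  "('m::topological_space, 'e::euclidean_space) chart set \<Rightarrow> 'm endo \<Rightarrow> bool" where
  "endo_field A \<phi> \<longleftrightarrow>
     (\<forall>p. \<forall>u\<in>tangent_space A p. \<forall>v\<in>tangent_space A p. \<forall>a b.
        \<phi> p (tv_lin a u b v) = tv_lin a (\<phi> p u) b (\<phi> p v)) \<and>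
     (\<forall>p. \<forall>u\<in>tangent_space A p. \<phi> p u \<in> tangent_space A p) \<and>
     (\<forall>X. vector_field A X \<longrightarrow> vector_field A (\<lambda>p. \<phi> p (X p)))"

definition symmetric_bilinear_field ::
  "('m::topological_space, 'e::euclidean_space) chart set \<Rightarrow> 'm bilform \<Rightarrow> bool" where
  "symmetric_bilinear_field A g \<longleftrightarrow>
     (\<forall>p. \<forall>u\<in>tangent_space A p. \<forall>v\<in>tangent_space A p. g p u v = g p v u) \<and>
     (\<forall>p. \<forall>u\<in>tangent_space A p. \<forall>v\<in>tangent_space A p. \<forall>w\<in>tangent_space A p. \<forall>a b.
        g p (tv_lin a u b v) w = a * g p u w + b * g p v w) \<and>
     (\<forall>X Y. vector_field A X \<and> vector_field A Y \<longrightarrow> smooth_fun A (\<lambda>p. g p (X p) (Y p)))"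

definition riemannian_metric ::
  "('m::topological_space, 'e::euclidean_space) chart set \<Rightarrow> 'm bilform \<Rightarrow> bool" where
  "riemannian_metric A g \<longleftrightarrow> symmetric_bilinear_field A g \<and>
     (\<forall>p. \<forall>u\<in>tangent_space A p. u \<noteq> (\<lambda>_. 0) \<longrightarrow> g p u u > 0)"

definition affine_connection ::
  "('m::topological_space, 'e::euclidean_space) chart set \<Rightarrow>
   ('m vfield \<Rightarrow> 'm vfield \<Rightarrow> 'm vfield) \<Rightarrow> bool" where
  "affine_connection A D \<longleftrightarrow>
     (\<forall>X Y. vector_field A X \<and> vector_field A Y \<longrightarrow> vector_field A (D X Y)) \<and>
     (\<forall>X Y Z. vector_field A X \<and> vector_field A Y \<and> vector_field A Z \<longrightarrow>
        D (vf_add X Y) Z = vf_add (D X Z) (D Y Z) \<and>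
        D X (vf_add Y Z) = vf_add (D X Y) (D X Z)) \<and>
     (\<forall>f X Y. smooth_fun A f \<and> vector_field A X \<and> vector_field A Y \<longrightarrow>
        D (vf_scale f X) Y = vf_scale f (D X Y) \<and>
        D X (vf_scale f Y) = vf_add (vf_scale (\<lambda>p. X p f) Y) (vf_scale f (D X Y)))"

definition levi_civita ::
  "('m::topological_space, 'e::euclidean_space) chart set \<Rightarrow> 'm bilform \<Rightarrow>
   ('m vfield \<Rightarrow> 'm vfield \<Rightarrow> 'm vfield) \<Rightarrow> bool" where
  "levi_civita A g D \<longleftrightarrow> affine_connection A D \<and>
     (\<forall>X Y. vector_field A X \<and> vector_field A Y \<longrightarrow>
        vf_diff (D X Y) (D Y X) = lie_bracket X Y) \<and>
     (\<forall>X Y Z. vector_field A X \<and> vector_field A Y \<and> vector_field A Z \<longrightarrow>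
        (\<forall>p. X p (\<lambda>q. g q (Y q) (Z q)) = g p (D X Y p) (Z p) + g p (Y p) (D X Z p)))"

definition curvature ::
  "('m vfield \<Rightarrow> 'm vfield \<Rightarrow> 'm vfield) \<Rightarrow> 'm vfield \<Rightarrow> 'm vfield \<Rightarrow> 'm vfield \<Rightarrow> 'm vfield" where
  "curvature D X Y Z =
     vf_diff (vf_diff (D X (D Y Z)) (D Y (D X Z))) (D (lie_bracket X Y) Z)"

definition sectional_curvature ::
  "'m bilform \<Rightarrow> ('m vfield \<Rightarrow> 'm vfield \<Rightarrow> 'm vfield) \<Rightarrow> 'm \<Rightarrow> 'm vfield \<Rightarrow> 'm vfield \<Rightarrow> real" where
  "sectional_curvature g D p X Y =
     g p (curvature D X Y Y p) (X p) /
     (g p (X p) (X p) * g p (Y p) (Y p) - (g p (X p) (Y p))\<^sup>2)"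

(* The Lie derivative of g along X vanishes. *)
definition killing_field ::
  "('m::topological_space, 'e::euclidean_space) chart set \<Rightarrow> 'm bilform \<Rightarrow> 'm vfield \<Rightarrow> bool" where
  "killing_field A g X \<longleftrightarrow> vector_field A X \<and>
     (\<forall>Y Z. vector_field A Y \<and> vector_field A Z \<longrightarrow>
        (\<forall>p. X p (\<lambda>q. g q (Y q) (Z q)) =
             g p (lie_bracket X Y p) (Z p) + g p (Y p) (lie_bracket X Z p)))"

section \<open>Three-dimensional Sasakian geometry\<close>

(* The exterior derivative with the factor 1/2. This is the normalisation for which
   d eta (X,Y) = g(X, phi Y) is compatible both with R(X,Y) xi = eta(Y) X - eta(X) Y and with
   [e2,e3] = -2 e1. *)
definition ext_deriv :: "'m oneform \<Rightarrow> 'm vfield \<Rightarrow> 'm vfield \<Rightarrow> 'm \<Rightarrow> real" where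
  "ext_deriv \<eta> X Y p =
     (X p (\<lambda>q. \<eta> q (Y q)) - Y p (\<lambda>q. \<eta> q (X q)) - \<eta> p (lie_bracket X Y p)) / 2"

(* eta wedge d eta has no zero; the displayed cyclic sum is a non-zero multiple of it. *)
definition contact_form ::
  "('m::topological_space, real^3) chart set \<Rightarrow> 'm oneform \<Rightarrow> bool" where
  "contact_form A \<eta> \<longleftrightarrow> one_form A \<eta> \<and>
     (\<forall>p. \<exists>X Y Z. vector_field A X \<and> vector_field A Y \<and> vector_field A Z \<and>
        \<eta> p (X p) * ext_deriv \<eta> Y Z p + \<eta> p (Y p) * ext_deriv \<eta> Z X p
          + \<eta> p (Z p) * ext_deriv \<eta> X Y p \<noteq> 0)"

definition contact_metric ::
  "('m::topological_space, real^3) chart set \<Rightarrow> 'm endo \<Rightarrow> 'm vfield \<Rightarrow> 'm oneform \<Rightarrow>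
   'm bilform \<Rightarrow> bool" where
  "contact_metric A \<phi> \<xi> \<eta> g \<longleftrightarrow>
     contact_form A \<eta> \<and> endo_field A \<phi> \<and> vector_field A \<xi> \<and> riemannian_metric A g \<and>
     (\<forall>p. \<eta> p (\<xi> p) = 1) \<and>
     (\<forall>X p. vector_field A X \<longrightarrow> ext_deriv \<eta> \<xi> X p = 0) \<and>
     (\<forall>p. \<forall>u\<in>tangent_space A p. \<eta> p u = g p u (\<xi> p)) \<and>
     (\<forall>p. \<forall>u\<in>tangent_space A p. \<phi> p (\<phi> p u) = tv_lin (-1) u (\<eta> p u) (\<xi> p)) \<and>
     (\<forall>p. \<forall>u\<in>tangent_space A p. \<forall>v\<in>tangent_space A p.
        g p (\<phi> p u) (\<phi> p v) = g p u v - \<eta> p u * \<eta> p v) \<and>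
     (\<forall>X Y p. vector_field A X \<and> vector_field A Y \<longrightarrow>
        ext_deriv \<eta> X Y p = g p (X p) (\<phi> p (Y p)))"

definition riemannian_sasakian ::
  "('m::topological_space, real^3) chart set \<Rightarrow> 'm endo \<Rightarrow> 'm vfield \<Rightarrow> 'm oneform \<Rightarrow>
   'm bilform \<Rightarrow> bool" where
  "riemannian_sasakian A \<phi> \<xi> \<eta> g \<longleftrightarrow> contact_metric A \<phi> \<xi> \<eta> g \<and>
     (\<exists>D. levi_civita A g D \<and>
        (\<forall>X Y. vector_field A X \<and> vector_field A Y \<longrightarrow>
           curvature D X Y \<xi> =
             vf_diff (vf_scale (\<lambda>p. \<eta> p (Y p)) X) (vf_scale (\<lambda>p. \<eta> p (X p)) Y)))"

(* r = 0: Riemannian; r = 1: Lorentzian, the metric being g' - 2 eta eta. *)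
definition sasakian ::
  "('m::topological_space, real^3) chart set \<Rightarrow> nat \<Rightarrow> 'm endo \<Rightarrow> 'm vfield \<Rightarrow> 'm oneform \<Rightarrow>
   'm bilform \<Rightarrow> bool" where
  "sasakian A r \<phi> \<xi> \<eta> g \<longleftrightarrow>
     (\<exists>g'. riemannian_sasakian A \<phi> \<xi> \<eta> g' \<and>
        (\<forall>p. \<forall>u\<in>tangent_space A p. \<forall>v\<in>tangent_space A p.
           g p u v = g' p u v - 2 * real r * \<eta> p u * \<eta> p v))"

definition sasakian_space_form ::
  "('m::{t2_space, second_countable_topology}, real^3) chart set \<Rightarrow> nat \<Rightarrow> 'm endo \<Rightarrow> 'm vfield \<Rightarrow>
   'm oneform \<Rightarrow> 'm bilform \<Rightarrow> real \<Rightarrow> bool" where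
  "sasakian_space_form A r \<phi> \<xi> \<eta> g H \<longleftrightarrow>
     smooth_atlas A \<and> simply_connected (UNIV :: 'm set) \<and> sasakian A r \<phi> \<xi> \<eta> g \<and>
     (\<exists>D. levi_civita A g D \<and>
        (\<forall>X p. vector_field A X \<and> X p \<noteq> (\<lambda>_. 0) \<and> g p (X p) (\<xi> p) = 0 \<longrightarrow>
           sectional_curvature g D p X (\<lambda>q. \<phi> q (X q)) = H))"

(* The matrix entries h_jj; h is diagonal and equal to its inverse. *)
definition hdiag :: "nat \<Rightarrow> 3 \<Rightarrow> real" where
  "hdiag r j = (if j = 1 then (-1) ^ r else 1)"

definition frame :: "('m::topological_space, real^3) chart set \<Rightarrow> (3 \<Rightarrow> 'm vfield) \<Rightarrow> bool" where
  "frame A e \<longleftrightarrow> (\<forall>j. vector_field A (e j)) \<and>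
     (\<forall>p. \<forall>v\<in>tangent_space A p. \<exists>!c::real^3. v = (\<lambda>f. \<Sum>j\<in>UNIV. c $ j * e j p f))"

(* The index type is 3, in which 3 = 0; e 1, e 2, e 3 are the three members of the frame. *)
definition sasakian_frame ::
  "('m::topological_space, real^3) chart set \<Rightarrow> nat \<Rightarrow> 'm vfield \<Rightarrow> 'm bilform \<Rightarrow> real \<Rightarrow>
   (3 \<Rightarrow> 'm vfield) \<Rightarrow> bool" where
  "sasakian_frame A r \<xi> g H e \<longleftrightarrow> frame A e \<and> e 1 = \<xi> \<and>
     (\<forall>p i j. g p (e i p) (e j p) = (if i = j then hdiag r i else 0)) \<and>
     lie_bracket (e 1) (e 2) = vf_scale (\<lambda>_. - ((H + (-1) ^ r * 3) / 2)) (e 3) \<and>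
     lie_bracket (e 1) (e 3) = vf_scale (\<lambda>_. (H + (-1) ^ r * 3) / 2) (e 2) \<and>
     lie_bracket (e 2) (e 3) = vf_scale (\<lambda>_. - 2) (e 1)"

definition coframe :: "(3 \<Rightarrow> 'm vfield) \<Rightarrow> 3 \<Rightarrow> 'm oneform" where
  "coframe e j p v = (THE c::real^3. v = (\<lambda>f. \<Sum>k\<in>UNIV. c $ k * e k p f)) $ j"

section \<open>Spinors\<close>

definition mat_scale :: "complex \<Rightarrow> complex^2^2 \<Rightarrow> complex^2^2" where
  "mat_scale c M = (\<chi> a b. c * M $ a $ b)"

definition pauli :: "3 \<Rightarrow> complex^2^2" where
  "pauli j =
     (if j = 1 then vector [vector [0, 1], vector [1, 0]]
      else if j = 2 then vector [vector [0, -\<i>], vector [\<i>, 0]]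
      else vector [vector [1, 0], vector [0, -1]])"

definition gam :: "nat \<Rightarrow> 3 \<Rightarrow> complex^2^2" where
  "gam r j = mat_scale (if j = 1 then (-\<i>) powi (int r - 1) else \<i>) (pauli j)"

definition gam_up :: "nat \<Rightarrow> 3 \<Rightarrow> complex^2^2" where
  "gam_up r j = mat_scale (of_real (hdiag r j)) (gam r j)"

(* Spinor fields, read in the trivialisation given by a Sasakian frame. *)
type_synonym 'm spinor = "'m \<Rightarrow> complex^2"

definition spinor_field ::
  "('m::topological_space, 'e::euclidean_space) chart set \<Rightarrow> 'm spinor \<Rightarrow> bool" where
  "spinor_field A \<psi> \<longleftrightarrow>
     (\<forall>i. smooth_fun A (\<lambda>p. Re (\<psi> p $ i)) \<and> smooth_fun A (\<lambda>p. Im (\<psi> p $ i)))"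

definition clifford :: "nat \<Rightarrow> (3 \<Rightarrow> 'm vfield) \<Rightarrow> 'm vfield \<Rightarrow> 'm spinor \<Rightarrow> 'm spinor" where
  "clifford r e X \<psi> =
     (\<lambda>p. (\<Sum>j\<in>UNIV. mat_scale (of_real (coframe e j p (X p))) (gam r j)) *v \<psi> p)"

definition spinor_deriv :: "'m vfield \<Rightarrow> 'm spinor \<Rightarrow> 'm spinor" where
  "spinor_deriv X \<psi> =
     (\<lambda>p. \<chi> i. Complex (X p (\<lambda>q. Re (\<psi> q $ i))) (X p (\<lambda>q. Im (\<psi> q $ i))))"

definition omega_S :: "nat \<Rightarrow> real \<Rightarrow> (3 \<Rightarrow> 'm vfield) \<Rightarrow> 'm vfield \<Rightarrow> 'm \<Rightarrow> complex^2^2" where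
  "omega_S r H e X p =
     mat_scale ((-\<i>) ^ r / 2)
       (\<Sum>j\<in>UNIV. mat_scale (of_real (coframe e j p (X p))) (gam r j)) +
     mat_scale (\<i> ^ r * of_real ((H + (-1) powi (int r - 1)) / 4) * of_real (coframe e 1 p (X p)))
       (gam r 1)"

definition spin_connection ::
  "nat \<Rightarrow> real \<Rightarrow> (3 \<Rightarrow> 'm vfield) \<Rightarrow> 'm vfield \<Rightarrow> 'm spinor \<Rightarrow> 'm spinor" where
  "spin_connection r H e X \<psi> = (\<lambda>p. spinor_deriv X \<psi> p + omega_S r H e X p *v \<psi> p)"

definition SqK_spinor ::
  "('m::topological_space, real^3) chart set \<Rightarrow> nat \<Rightarrow> 'm vfield \<Rightarrow> 'm oneform \<Rightarrow> real \<Rightarrow>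
   (3 \<Rightarrow> 'm vfield) \<Rightarrow> real \<Rightarrow> real \<Rightarrow> 'm spinor \<Rightarrow> bool" where
  "SqK_spinor A r \<xi> \<eta> H e a b \<psi> \<longleftrightarrow> spinor_field A \<psi> \<and>
     (\<forall>X. vector_field A X \<longrightarrow>
        (\<forall>p. spin_connection r H e X \<psi> p =
             (of_real a * \<i> ^ r) *s clifford r e X \<psi> p +
             (of_real b * \<i> ^ r * of_real (\<eta> p (X p))) *s clifford r e \<xi> \<psi> p))"

definition killing_spinor ::
  "('m::topological_space, real^3) chart set \<Rightarrow> nat \<Rightarrow> real \<Rightarrow> (3 \<Rightarrow> 'm vfield) \<Rightarrow>
   'm spinor \<Rightarrow> bool" where
  "killing_spinor A r H e \<psi> \<longleftrightarrow> spinor_field A \<psi> \<and>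
     (\<exists>\<mu>::complex. \<forall>X. vector_field A X \<longrightarrow>
        (\<forall>p. spin_connection r H e X \<psi> p = \<mu> *s clifford r e X \<psi> p))"

definition S0 ::
  "('m::topological_space, real^3) chart set \<Rightarrow> nat \<Rightarrow> 'm vfield \<Rightarrow> 'm oneform \<Rightarrow> real \<Rightarrow>
   (3 \<Rightarrow> 'm vfield) \<Rightarrow> 'm spinor set" where
  "S0 A r \<xi> \<eta> H e = {\<psi>. SqK_spinor A r \<xi> \<eta> H e ((-1) ^ r / 2) ((H - (-1) ^ r) / 4) \<psi>}"

definition spin_form :: "nat \<Rightarrow> complex^2 \<Rightarrow> complex^2 \<Rightarrow> complex" where
  "spin_form r u v = (\<Sum>i\<in>UNIV. cnj (u $ i) * (((\<lambda>w. gam r 1 *v w) ^^ r) v) $ i)"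

definition dirac_coeff :: "nat \<Rightarrow> 3 \<Rightarrow> complex^2 \<Rightarrow> complex" where
  "dirac_coeff r j u = (-\<i>) powi (int r - 1) * spin_form r u (gam_up r j *v u)"

(* By dirac_coeff_real below, Re only changes the type. *)
definition dirac_current :: "nat \<Rightarrow> (3 \<Rightarrow> 'm vfield) \<Rightarrow> 'm spinor \<Rightarrow> 'm vfield" where
  "dirac_current r e \<psi> = (\<lambda>p f. \<Sum>j\<in>UNIV. Re (dirac_coeff r j (\<psi> p)) * e j p f)"

lemma dirac_coeff_real:
  assumes "r \<in> {0, 1}"
  shows "dirac_coeff r j u \<in> \<real>"
  using assms exhaust_3[of j]
  by (auto simp: dirac_coeff_def spin_form_def gam_up_def gam_def pauli_def mat_scale_def
      hdiag_def matrix_vector_mult_def sum_2 complex_is_Real_iff power_int_minus)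

lemma clifford_relation:
  assumes "r \<in> {0, 1}"
  shows "gam r i ** gam r j + gam r j ** gam r i =
         mat_scale (of_real (- 2 * (if i = j then hdiag r i else 0))) (mat 1)"
  using assms exhaust_3[of i] exhaust_3[of j]
  by (auto simp: gam_def pauli_def mat_scale_def hdiag_def matrix_matrix_mult_def sum_2 vec_eq_iff
      mat_def forall_2 power_int_minus)

end

theory Submission
  imports Defs
begin

text \<open>
  In a Sasakian frame the equation of an SqK-spinor of type \<open>(a, b)\<close> reads
  \<open>e\<^sub>j \<psi> = \<i>\<^sup>r (\<alpha> + \<delta>\<^sub>j\<^sub>1 \<beta>) \<gamma>\<^sub>j \<psi>\<close> with constants \<open>\<alpha>\<close>, \<open>\<beta>\<close> that vanish together exactly for
  the type of the spinors in \<open>S0\<close>. The \<open>(1,2)\<close> and \<open>(1,3)\<close> components of the Killing equation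
  for \<open>J\<close> collapse to \<open>b J\<^sup>3 = 0\<close> and \<open>b J\<^sup>2 = 0\<close>, and \<open>b \<noteq> 0\<close> because \<open>\<psi>\<close> is not a Killing spinor.
  On the other hand \<open>J\<^sup>2 = J\<^sup>3 = 0\<close> at a point is equivalent to the eigenvalue equation for
  \<open>\<xi>\<close> there. So both sides of the equivalence imply \<open>J\<^sup>2 = J\<^sup>3 = 0\<close> everywhere. Then
  \<open>0 = e\<^sub>2 J\<^sup>3 = 2 \<alpha> J\<^sup>1\<close> gives \<open>\<alpha> = 0\<close>, and \<open>[e\<^sub>2, e\<^sub>3] = - 2 e\<^sub>1\<close> applied to \<open>\<psi>\<close> gives \<open>\<beta> = 0\<close>.
  Hence \<open>\<psi>\<close> lies in \<open>S0\<close> and is constant in the frame, \<open>J\<close> is a constant multiple of \<open>\<xi>\<close>,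
  which is a Killing field, and the sign in the eigenvalue equation is the same at all points.
\<close>

section \<open>Functions of class \<open>C\<^sup>k\<close> and derivations\<close>

text \<open>On an open set, Frechet derivatives depend only on the values nearby, so agreement on
  \<open>S\<close> passes to each derivative and the induction goes through. This is what lets the
  sum and product formulas, which hold only on \<open>S\<close>, stand in for
  \<open>frechet_derivative\<close>.\<close>

lemma Ck_on_cong:
  assumes "open S" "Ck_on k S f" "\<And>x. x \<in> S \<Longrightarrow> f x = g x"
  shows "Ck_on k S g"
  using assms(2,3)
proof (induction k arbitrary: f g)
  case 0
  then show ?case
    by (metis Ck_on.simps(1) continuous_on_cong)
next
  case (Suc k)
  have der: "(g has_derivative frechet_derivative f (at x)) (at x)" if "x \<in> S" for x
    using Suc.prems that assms(1)
    by (auto intro: has_derivative_transform_within_open simp: frechet_derivative_works)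
  have eq: "frechet_derivative f (at x) = frechet_derivative g (at x)" if "x \<in> S" for x
    using frechet_derivative_at[OF der[OF that]] .
  have "Ck_on k S (\<lambda>x. frechet_derivative g (at x) v)" for v
    using Suc.IH[of "\<lambda>x. frechet_derivative f (at x) v" "\<lambda>x. frechet_derivative g (at x) v"]
      Suc.prems eq by simp
  then show ?case
    using der by (auto simp: differentiable_def)
qed

lemma Ck_on_SucD: "Ck_on (Suc k) S f \<Longrightarrow> Ck_on k S f"
proof (induction k arbitrary: f)
  case 0
  then show ?case
    by (auto intro!: continuous_at_imp_continuous_on differentiable_imp_continuous_within)
next
  case (Suc k)
  then show ?case
    by (metis Ck_on.simps(2))
qed

lemma Ck_on_const: "Ck_on k S (\<lambda>_. c)"
  by (induction k arbitrary: c) (auto simp: frechet_derivative_const)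

lemma Ck_on_lin:
  fixes f g :: "'e::real_normed_vector \<Rightarrow> real"
  assumes "open S" "Ck_on k S f" "Ck_on k S g"
  shows "Ck_on k S (\<lambda>x. a * f x + b * g x)"
  using assms(2,3)
proof (induction k arbitrary: f g)
  case 0
  then show ?case
    by (auto intro!: continuous_intros)
next
  case (Suc k)
  have der: "((\<lambda>x. a * f x + b * g x) has_derivative
      (\<lambda>v. a * frechet_derivative f (at x) v + b * frechet_derivative g (at x) v)) (at x)"
    if "x \<in> S" for x
    using Suc.prems that
    by (auto intro!: derivative_eq_intros simp: frechet_derivative_works)
  have eq: "a * frechet_derivative f (at x) v + b * frechet_derivative g (at x) v
      = frechet_derivative (\<lambda>x. a * f x + b * g x) (at x) v" if "x \<in> S" for x v
    using fun_cong[OF frechet_derivative_at[OF der[OF that]]] .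
  have "Ck_on k S (\<lambda>x. frechet_derivative (\<lambda>x. a * f x + b * g x) (at x) v)" for v
    by (rule Ck_on_cong[OF \<open>open S\<close> Suc.IH eq]) (use Suc.prems in auto)
  then show ?case
    using der by (auto simp: differentiable_def)
qed

lemma Ck_on_mult:
  fixes f g :: "'e::real_normed_vector \<Rightarrow> real"
  assumes "open S" "Ck_on k S f" "Ck_on k S g"
  shows "Ck_on k S (\<lambda>x. f x * g x)"
  using assms(2,3)
proof (induction k arbitrary: f g)
  case 0
  then show ?case
    by (auto intro!: continuous_intros)
next
  case (Suc k)
  have der: "((\<lambda>x. f x * g x) has_derivative
      (\<lambda>v. f x * frechet_derivative g (at x) v + frechet_derivative f (at x) v * g x)) (at x)"
    if "x \<in> S" for x
    using Suc.prems that
    by (auto intro!: has_derivative_mult simp: frechet_derivative_works)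
  \<comment> \<open>The coefficients \<open>1\<close> put the Leibniz formula into the shape that
    \<open>Ck_on_lin\<close> expects.\<close>
  have eq: "1 * (f x * frechet_derivative g (at x) v) + 1 * (frechet_derivative f (at x) v * g x)
      = frechet_derivative (\<lambda>x. f x * g x) (at x) v" if "x \<in> S" for x v
    using fun_cong[OF frechet_derivative_at[OF der[OF that]]] by simp
  \<comment> \<open>The Leibniz formula contains the undifferentiated factors, so these are needed
    in class \<open>k\<close> alongside their derivatives.\<close>
  have Ck: "Ck_on k S f" "Ck_on k S g"
    using Suc.prems Ck_on_SucD by blast+
  have Ck_der: "Ck_on k S (\<lambda>x. frechet_derivative f (at x) v)"
    "Ck_on k S (\<lambda>x. frechet_derivative g (at x) v)" for v
    using Suc.prems by simp_all
  have "Ck_on k S (\<lambda>x. frechet_derivative (\<lambda>x. f x * g x) (at x) v)" for v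
    by (rule Ck_on_cong[OF \<open>open S\<close> Ck_on_lin[OF \<open>open S\<close> Suc.IH Suc.IH] eq])
      (rule Ck Ck_der)+
  then show ?case
    using der by (auto simp: differentiable_def)
qed

section \<open>Smooth functions, derivations and vector fields on a manifold\<close>

locale smooth_manifold =
  fixes A :: "('m::{t2_space, second_countable_topology}, 'e::euclidean_space) chart set"
  assumes atlas: "smooth_atlas A"
begin

lemma open_chart_image: "(U, c) \<in> A \<Longrightarrow> open (c ` U)"
  using atlas unfolding smooth_atlas_def by blast

lemma smooth_fun_lin:
  assumes "smooth_fun A f" "smooth_fun A g"
  shows "smooth_fun A (\<lambda>x. a * f x + b * g x)"
  unfolding smooth_fun_def smooth_on_def
proof (clarify)
  fix U c k
  assume Uc: "(U, c) \<in> A"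
  then have "Ck_on k (c ` U) (f \<circ> inv_into U c)" "Ck_on k (c ` U) (g \<circ> inv_into U c)"
    using assms unfolding smooth_fun_def smooth_on_def by blast+
  from Ck_on_lin[OF open_chart_image[OF Uc] this, of a b]
  show "Ck_on k (c ` U) ((\<lambda>x. a * f x + b * g x) \<circ> inv_into U c)"
    unfolding o_def .
qed

lemma smooth_fun_mult:
  assumes "smooth_fun A f" "smooth_fun A g"
  shows "smooth_fun A (\<lambda>x. f x * g x)"
  unfolding smooth_fun_def smooth_on_def
proof (clarify)
  fix U c k
  assume Uc: "(U, c) \<in> A"
  then have "Ck_on k (c ` U) (f \<circ> inv_into U c)" "Ck_on k (c ` U) (g \<circ> inv_into U c)"
    using assms unfolding smooth_fun_def smooth_on_def by blast+
  from Ck_on_mult[OF open_chart_image[OF Uc] this]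
  show "Ck_on k (c ` U) ((\<lambda>x. f x * g x) \<circ> inv_into U c)"
    unfolding o_def .
qed

lemma smooth_fun_const: "smooth_fun A (\<lambda>_. c)"
  by (auto simp: smooth_fun_def smooth_on_def o_def Ck_on_const)

lemma smooth_fun_scale: "smooth_fun A f \<Longrightarrow> smooth_fun A (\<lambda>x. a * f x)"
  using smooth_fun_lin[of f f a 0] by simp

lemma smooth_fun_add:
  "smooth_fun A f \<Longrightarrow> smooth_fun A g \<Longrightarrow> smooth_fun A (\<lambda>x. f x + g x)"
  using smooth_fun_lin[of f g 1 1] by simp

lemma smooth_fun_diff:
  "smooth_fun A f \<Longrightarrow> smooth_fun A g \<Longrightarrow> smooth_fun A (\<lambda>x. f x - g x)"
  using smooth_fun_lin[of f g 1 "-1"] by simp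

lemma smooth_fun_sum:
  "(\<And>j. j \<in> S \<Longrightarrow> smooth_fun A (f j)) \<Longrightarrow> smooth_fun A (\<lambda>x. \<Sum>j\<in>S. f j x)"
  by (induction S rule: infinite_finite_induct) (auto intro: smooth_fun_add smooth_fun_const)

lemma smooth_fun_minus: "smooth_fun A f \<Longrightarrow> smooth_fun A (\<lambda>x. - f x)"
  using smooth_fun_scale[of f "-1"] by simp

lemmas smooth_intros = smooth_fun_mult smooth_fun_const smooth_fun_minus smooth_fun_scale smooth_fun_add
  smooth_fun_diff smooth_fun_sum

context
  fixes p v
  assumes v: "v \<in> tangent_space A p"
begin

lemma tangent_mult:
  "smooth_fun A f \<Longrightarrow> smooth_fun A g \<Longrightarrow> v (\<lambda>x. f x * g x) = f p * v g + g p * v f"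
  using v unfolding tangent_space_def by blast

lemma tangent_lin:
  "smooth_fun A f \<Longrightarrow> smooth_fun A g \<Longrightarrow> v (\<lambda>x. a * f x + b * g x) = a * v f + b * v g"
  using v unfolding tangent_space_def by blast

lemma tangent_nonsmooth: "\<not> smooth_fun A f \<Longrightarrow> v f = 0"
  using v unfolding tangent_space_def by blast

lemma tangent_scale: "smooth_fun A f \<Longrightarrow> v (\<lambda>x. a * f x) = a * v f"
  using tangent_lin[of f f a 0] by simp

lemma tangent_minus: "smooth_fun A f \<Longrightarrow> v (\<lambda>x. - f x) = - v f"
  using tangent_scale[of f "-1"] by simp

lemma tangent_add:
  "smooth_fun A f \<Longrightarrow> smooth_fun A g \<Longrightarrow> v (\<lambda>x. f x + g x) = v f + v g"
  using tangent_lin[of f g 1 1] by simp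

lemma tangent_diff:
  "smooth_fun A f \<Longrightarrow> smooth_fun A g \<Longrightarrow> v (\<lambda>x. f x - g x) = v f - v g"
  using tangent_lin[of f g 1 "-1"] by simp

lemma tangent_const: "v (\<lambda>_. c) = 0"
proof -
  \<comment> \<open>The Leibniz rule for the product 1 times 1 reads
    \<open>v 1 = v 1 + v 1\<close>.\<close>
  have "v (\<lambda>_. 1) = 0"
    using tangent_mult[OF smooth_fun_const smooth_fun_const, of 1 1] by simp
  then show ?thesis
    using tangent_scale[OF smooth_fun_const, of c 1] by simp
qed

lemma tangent_sum:
  "(\<And>j. j \<in> S \<Longrightarrow> smooth_fun A (f j)) \<Longrightarrow> v (\<lambda>x. \<Sum>j\<in>S. f j x) = (\<Sum>j\<in>S. v (f j))"
proof (induction S rule: infinite_finite_induct)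
  case (insert j S)
  then have "smooth_fun A (f j)" "smooth_fun A (\<lambda>x. \<Sum>j\<in>S. f j x)"
    by (auto intro!: smooth_fun_sum)
  with insert show ?case
    by (simp add: tangent_add)
qed (simp_all add: tangent_const)

end

lemma tangent_space_lin:
  assumes u: "u \<in> tangent_space A p" and v: "v \<in> tangent_space A p"
  shows "(\<lambda>f. a * u f + b * v f) \<in> tangent_space A p"
  unfolding tangent_space_def mem_Collect_eq
proof (intro conjI allI impI)
  fix f g c d
  assume "smooth_fun A f \<and> smooth_fun A g"
  then have fg: "smooth_fun A f" "smooth_fun A g"
    by auto
  show "a * u (\<lambda>x. c * f x + d * g x) + b * v (\<lambda>x. c * f x + d * g x)
      = c * (a * u f + b * v f) + d * (a * u g + b * v g)"
    unfolding tangent_lin[OF u fg] tangent_lin[OF v fg] by (simp add: algebra_simps)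
  show "a * u (\<lambda>x. f x * g x) + b * v (\<lambda>x. f x * g x)
      = f p * (a * u g + b * v g) + g p * (a * u f + b * v f)"
    unfolding tangent_mult[OF u fg] tangent_mult[OF v fg] by (simp add: algebra_simps)
next
  fix f
  assume "\<not> smooth_fun A f"
  then show "a * u f + b * v f = 0"
    by (simp add: tangent_nonsmooth[OF u] tangent_nonsmooth[OF v])
qed

lemma tangent_space_zero: "(\<lambda>_. 0) \<in> tangent_space A p"
  by (auto simp: tangent_space_def)

lemma tangent_space_sum:
  "(\<And>j. j \<in> S \<Longrightarrow> X j \<in> tangent_space A p) \<Longrightarrow>
    (\<lambda>f. \<Sum>j\<in>S. a j * X j f) \<in> tangent_space A p"
proof (induction S rule: infinite_finite_induct)
  case (insert j S)
  then show ?case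
    using tangent_space_lin[of "X j" p "\<lambda>f. \<Sum>j\<in>S. a j * X j f" "a j" 1] by auto
qed (auto simp: tangent_space_zero)

lemma vector_field_tangent: "vector_field A X \<Longrightarrow> X p \<in> tangent_space A p"
  by (simp add: vector_field_def)

text \<open>For non-smooth \<open>f\<close> the function is identically zero, by the default value
  built into \<open>tangent_space\<close>. Bracket computations can therefore be carried out for
  every argument \<open>f\<close>, as equality of vector fields in HOL demands.\<close>

lemma vector_field_smooth: "vector_field A X \<Longrightarrow> smooth_fun A (\<lambda>p. X p f)"
proof (cases "smooth_fun A f")
  case False
  moreover assume "vector_field A X"
  ultimately have "(\<lambda>p. X p f) = (\<lambda>_. 0)"
    using tangent_nonsmooth[OF vector_field_tangent] by blast
  then show ?thesis
    by (simp add: smooth_fun_const)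
qed (simp add: vector_field_def)

lemma vector_field_sum:
  assumes "\<And>j. j \<in> S \<Longrightarrow> vector_field A (X j)" "\<And>j. j \<in> S \<Longrightarrow> smooth_fun A (a j)"
  shows "vector_field A (\<lambda>p f. \<Sum>j\<in>S. a j p * X j p f)"
  unfolding vector_field_def
proof (intro conjI allI impI)
  show "(\<lambda>f. \<Sum>j\<in>S. a j p * X j p f) \<in> tangent_space A p" for p
    by (intro tangent_space_sum) (use assms in \<open>auto simp: vector_field_def\<close>)
  show "smooth_fun A (\<lambda>p. \<Sum>j\<in>S. a j p * X j p f)" if "smooth_fun A f" for f
    by (intro smooth_fun_sum smooth_fun_mult) (use assms that in \<open>auto simp: vector_field_def\<close>)
qed

text \<open>The Leibniz rule of the bracket in its second slot: differentiating the coefficients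
  gives the first term, and the second derivatives pair up into the brackets with the
  \<open>Y j\<close>.\<close>

lemma lie_bracket_sum:
  assumes "vector_field A X" "\<And>j. j \<in> S \<Longrightarrow> vector_field A (Y j)"
    and "\<And>j. j \<in> S \<Longrightarrow> smooth_fun A (a j)"
  shows "lie_bracket X (\<lambda>p f. \<Sum>j\<in>S. a j p * Y j p f) p f =
    (\<Sum>j\<in>S. X p (a j) * Y j p f + a j p * lie_bracket X (Y j) p f)"
proof -
  have "X p (\<lambda>q. \<Sum>j\<in>S. a j q * Y j q f) = (\<Sum>j\<in>S. X p (\<lambda>q. a j q * Y j q f))"
    by (intro tangent_sum[OF vector_field_tangent[OF assms(1)]] smooth_fun_mult
        vector_field_smooth assms)
  also have "\<dots> = (\<Sum>j\<in>S. a j p * X p (\<lambda>q. Y j q f) + Y j p f * X p (a j))"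
    by (intro sum.cong refl tangent_mult[OF vector_field_tangent[OF assms(1)]]
        vector_field_smooth assms)
  finally show ?thesis
    unfolding lie_bracket_def by (simp only: sum_subtractf[symmetric]) (simp add: algebra_simps)
qed

section \<open>Coordinate derivatives and constancy on connected manifolds\<close>

lemma differentiable_chart:
  assumes "smooth_fun A f" "(U, c) \<in> A" "x \<in> c ` U"
  shows "(f \<circ> inv_into U c) differentiable (at x)"
proof -
  have "Ck_on (Suc 0) (c ` U) (f \<circ> inv_into U c)"
    using assms unfolding smooth_fun_def smooth_on_def by blast
  then show ?thesis
    using assms(3) by auto
qed

lemma inv_into_chart: "(U, c) \<in> A \<Longrightarrow> p \<in> U \<Longrightarrow> inv_into U c (c p) = p"
  using atlas unfolding smooth_atlas_def homeomorphism_def by blast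

text \<open>Directional derivatives in a chart supply enough derivations to detect a vanishing
  differential. The cut-off to 0 matches the convention of \<open>tangent_space\<close> for
  non-smooth functions.\<close>

lemma coordinate_derivation_tangent:
  assumes "(U, c) \<in> A" "p \<in> U"
  shows "(\<lambda>f. if smooth_fun A f then frechet_derivative (f \<circ> inv_into U c) (at (c p)) w else 0)
    \<in> tangent_space A p"
proof -
  define D where "D (f :: 'm \<Rightarrow> real) = frechet_derivative (f \<circ> inv_into U c) (at (c p))" for f
  have D: "((f \<circ> inv_into U c) has_derivative D f) (at (c p))" if "smooth_fun A f" for f
    unfolding D_def using differentiable_chart[OF that assms(1)] assms
    by (simp add: frechet_derivative_works)
  have lin: "D (\<lambda>x. a * f x + b * g x) w = a * D f w + b * D g w"
    if "smooth_fun A f" "smooth_fun A g" for f g a b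
  proof -
    have "((\<lambda>x. a * (f \<circ> inv_into U c) x + b * (g \<circ> inv_into U c) x) has_derivative
        (\<lambda>w. a * D f w + b * D g w)) (at (c p))"
      by (intro has_derivative_add has_derivative_mult_right D that)
    then have "((\<lambda>x. a * f x + b * g x) \<circ> inv_into U c has_derivative
        (\<lambda>w. a * D f w + b * D g w)) (at (c p))"
      by (simp add: o_def)
    then show ?thesis
      using has_derivative_unique[OF D[OF smooth_fun_lin[OF that]]] by metis
  qed
  have mult: "D (\<lambda>x. f x * g x) w = f p * D g w + g p * D f w"
    if "smooth_fun A f" "smooth_fun A g" for f g
  proof -
    have "((\<lambda>x. f x * g x) \<circ> inv_into U c has_derivative
        (\<lambda>w. f p * D g w + D f w * g p)) (at (c p))"
      using has_derivative_mult[OF D[OF that(1)] D[OF that(2)]] inv_into_chart[OF assms]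
      by (simp add: o_def)
    from has_derivative_unique[OF D[OF smooth_fun_mult[OF that]] this] show ?thesis
      by (simp add: mult.commute)
  qed
  have "(\<lambda>f. if smooth_fun A f then D f w else 0) \<in> tangent_space A p"
    unfolding tangent_space_def mem_Collect_eq
  proof (intro conjI allI impI)
    fix f g a b
    assume "smooth_fun A f \<and> smooth_fun A g"
    then have fg: "smooth_fun A f" "smooth_fun A g"
      by auto
    let ?v = "\<lambda>f. if smooth_fun A f then D f w else 0"
    show "?v (\<lambda>x. a * f x + b * g x) = a * ?v f + b * ?v g"
      using lin[OF fg, of a b] fg smooth_fun_lin[OF fg, of a b] by presburger
    show "?v (\<lambda>x. f x * g x) = f p * ?v g + g p * ?v f"
      using mult[OF fg] fg smooth_fun_mult[OF fg] by presburger
  qed simp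
  then show ?thesis
    unfolding D_def .
qed

text \<open>The coordinate derivations show that \<open>f\<close> has derivative zero in every
  chart, hence is locally constant; connectedness makes it constant.\<close>

lemma constant_if_derivations_vanish:
  assumes "smooth_fun A f" "\<And>p v. v \<in> tangent_space A p \<Longrightarrow> v f = 0"
    and "connected (UNIV :: 'm set)"
  shows "f p = f q"
proof (rule connected_local_const[OF assms(3) UNIV_I UNIV_I], intro ballI)
  fix p :: 'm
  have "p \<in> (\<Union>(U, c)\<in>A. U)"
    using atlas by (simp add: smooth_atlas_def)
  then obtain U c where Uc: "(U, c) \<in> A" and p: "p \<in> U"
    by blast
  let ?F = "f \<circ> inv_into U c"
  have zero: "(?F has_derivative (\<lambda>_. 0)) (at x)" if x: "x \<in> c ` U" for x
  proof -
    obtain q where q: "q \<in> U" "x = c q"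
      using x by blast
    have "frechet_derivative ?F (at x) = (\<lambda>_. 0)"
      unfolding q(2) fun_eq_iff
      using assms(2)[OF coordinate_derivation_tangent[OF Uc q(1)]] assms(1) by presburger
    then show ?thesis
      using differentiable_chart[OF assms(1) Uc x] by (simp add: frechet_derivative_works)
  qed
  obtain d where d: "d > 0" "ball (c p) d \<subseteq> c ` U"
    using open_chart_image[OF Uc] p open_contains_ball by blast
  have U: "open U" "continuous_on U c"
    using atlas Uc unfolding smooth_atlas_def homeomorphism_def by blast+
  \<comment> \<open>Points near \<open>p\<close> lie in the chart domain and land in a ball inside
    its image; on this convex set a zero derivative forces constancy.\<close>
  have "eventually (\<lambda>q. q \<in> U \<and> c q \<in> ball (c p) d) (at p)"
  proof (rule eventually_conj)
    show "eventually (\<lambda>q. q \<in> U) (at p)"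
      using U p by (metis eventually_at_topological)
    show "eventually (\<lambda>q. c q \<in> ball (c p) d) (at p)"
    proof (rule topological_tendstoD)
      show "c \<midarrow>p\<rightarrow> c p"
        using U p by (simp add: continuous_on_eq_continuous_at isCont_def)
    qed (use d(1) in auto)
  qed
  then show "eventually (\<lambda>q. f p = f q) (at p within UNIV)"
  proof (rule eventually_mono)
    fix q
    assume q: "q \<in> U \<and> c q \<in> ball (c p) d"
    obtain k where "\<And>x. x \<in> ball (c p) d \<Longrightarrow> ?F x = k"
      using has_derivative_zero_constant[of "ball (c p) d" ?F] zero d
      by (metis convex_ball has_derivative_at_withinI subsetD)
    then have "?F (c p) = ?F (c q)"
      using q d(1) by (metis centre_in_ball)
    then show "f p = f q"
      using inv_into_chart[OF Uc] p q by simp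
  qed
qed

end

section \<open>Killing fields in a Sasakian frame\<close>

text \<open>The structure constants of the frame: the coefficient of \<open>e l\<close> in the
  bracket of \<open>e i\<close> and \<open>e j\<close>, with the three given brackets completed by
  antisymmetry.\<close>

definition frame_structure :: "nat \<Rightarrow> real \<Rightarrow> 3 \<Rightarrow> 3 \<Rightarrow> 3 \<Rightarrow> real" where
  "frame_structure r H i j l =
     (let k = (H + (-1) ^ r * 3) / 2 in
      if i = 1 \<and> j = 2 \<and> l = 3 then - k else if i = 2 \<and> j = 1 \<and> l = 3 then k
      else if i = 1 \<and> j = 3 \<and> l = 2 then k else if i = 3 \<and> j = 1 \<and> l = 2 then - k
      else if i = 2 \<and> j = 3 \<and> l = 1 then - 2 else if i = 3 \<and> j = 2 \<and> l = 1 then 2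
      else 0)"

locale sasakian_metric_frame = smooth_manifold A
  for A :: "('m::{t2_space, second_countable_topology}, real^3) chart set" +
  fixes r :: nat and \<xi> :: "'m vfield" and g :: "'m bilform" and H :: real and e :: "3 \<Rightarrow> 'm vfield"
  assumes sasakian_frame: "sasakian_frame A r \<xi> g H e"
    and metric: "symmetric_bilinear_field A g"
begin

lemma frame_vector_field: "vector_field A (e j)"
  using sasakian_frame by (simp add: sasakian_frame_def frame_def)

lemma frame_tangent: "e j p \<in> tangent_space A p"
  using frame_vector_field vector_field_tangent by blast

lemma frame_Reeb: "e 1 = \<xi>"
  using sasakian_frame by (simp add: sasakian_frame_def)

lemma frame_orthonormal: "g p (e i p) (e j p) = (if i = j then hdiag r i else 0)"
  using sasakian_frame by (simp add: sasakian_frame_def)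

lemma frame_expansion:
  assumes "v \<in> tangent_space A p"
  obtains c :: "real^3" where "v = (\<lambda>f. \<Sum>j\<in>UNIV. c $ j * e j p f)"
  using sasakian_frame assms unfolding sasakian_frame_def frame_def by blast

text \<open>The uniqueness clause of \<open>frame\<close> determines the definite description in
  \<open>coframe\<close>; the coordinate vector of \<open>e i\<close> is
  \<open>axis i 1\<close>.\<close>

lemma coframe_frame: "coframe e j p (e i p) = (if j = i then 1 else 0)"
proof -
  have "\<exists>!c::real^3. e i p = (\<lambda>f. \<Sum>k\<in>UNIV. c $ k * e k p f)"
    using sasakian_frame frame_tangent unfolding sasakian_frame_def frame_def by blast
  moreover have "e i p = (\<lambda>f. \<Sum>k\<in>UNIV. axis i 1 $ k * e k p f)"
    by (simp add: axis_def if_distrib[of "\<lambda>x. x * _"] cong: if_cong)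
  ultimately have "(THE c::real^3. e i p = (\<lambda>f. \<Sum>k\<in>UNIV. c $ k * e k p f)) = axis i 1"
    by (intro the1_equality)
  then show ?thesis
    by (simp add: coframe_def axis_def)
qed

lemma lie_bracket_frame:
  "lie_bracket (e i) (e j) p f = (\<Sum>l\<in>UNIV. frame_structure r H i j l * e l p f)"
proof -
  define k where "k = (H + (-1) ^ r * 3) / 2"
  have br: "lie_bracket (e 1) (e 2) p f = - k * e 3 p f"
    "lie_bracket (e 1) (e 3) p f = k * e 2 p f" "lie_bracket (e 2) (e 3) p f = - 2 * e 1 p f"
    using sasakian_frame unfolding sasakian_frame_def vf_scale_def k_def fun_eq_iff by blast+
  have anti: "lie_bracket X Y p f = - lie_bracket Y X p f" for X Y :: "'m vfield"
    by (simp add: lie_bracket_def)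
  have refl: "lie_bracket X X p f = 0" for X :: "'m vfield"
    by (simp add: lie_bracket_def)
  show ?thesis
    using exhaust_3[of i] exhaust_3[of j] br anti[of "e 2" "e 1"] anti[of "e 3" "e 1"]
      anti[of "e 3" "e 2"] refl
    by (auto simp: sum_3 frame_structure_def k_def[symmetric] Let_def)
qed

lemma metric_sym:
  "u \<in> tangent_space A p \<Longrightarrow> v \<in> tangent_space A p \<Longrightarrow> g p u v = g p v u"
  using metric unfolding symmetric_bilinear_field_def by blast

lemma metric_lin:
  "u \<in> tangent_space A p \<Longrightarrow> v \<in> tangent_space A p \<Longrightarrow> w \<in> tangent_space A p \<Longrightarrow>
    g p (\<lambda>f. a * u f + b * v f) w = a * g p u w + b * g p v w"
  using metric unfolding symmetric_bilinear_field_def tv_lin_def by blast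

lemma metric_smooth:
  "vector_field A X \<Longrightarrow> vector_field A Y \<Longrightarrow> smooth_fun A (\<lambda>p. g p (X p) (Y p))"
  using metric unfolding symmetric_bilinear_field_def by blast

lemma metric_frame_left:
  assumes "w \<in> tangent_space A p"
  shows "g p (\<lambda>f. \<Sum>j\<in>S. a j * e j p f) w = (\<Sum>j\<in>S. a j * g p (e j p) w)"
proof (induction S rule: infinite_finite_induct)
  case (insert j S)
  have "(\<lambda>f. \<Sum>j\<in>S. a j * e j p f) \<in> tangent_space A p"
    by (intro tangent_space_sum frame_tangent)
  from metric_lin[OF frame_tangent this assms, of "a j" j 1] insert show ?case
    by simp
next
  case empty
  then show ?case
    \<comment> \<open>Linearity with both coefficients 0 evaluates the metric on the zero vector,
      which is what the empty sum denotes.\<close>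
    using metric_lin[OF assms assms assms, of 0 0] by simp
next
  case (infinite S)
  then show ?case
    using metric_lin[OF assms assms assms, of 0 0] by simp
qed

lemma metric_frame:
  "g p (\<lambda>f. \<Sum>j\<in>UNIV. a j * e j p f) (\<lambda>f. \<Sum>j\<in>UNIV. b j * e j p f)
    = (\<Sum>j\<in>UNIV. hdiag r j * a j * b j)"
proof -
  have tan: "(\<lambda>f. \<Sum>j\<in>UNIV. c j * e j p f) \<in> tangent_space A p" for c
    by (intro tangent_space_sum frame_tangent)
  have "g p (e j p) (\<lambda>f. \<Sum>j\<in>UNIV. b j * e j p f) = b j * hdiag r j" for j
    by (simp add: metric_sym[OF frame_tangent tan] metric_frame_left[OF frame_tangent]
        frame_orthonormal if_distrib[of "\<lambda>x. _ * x"] cong: if_cong)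
  then show ?thesis
    by (simp add: metric_frame_left[OF tan] ac_simps)
qed

lemma metric_frame_right:
  "g p (\<lambda>f. \<Sum>j\<in>UNIV. a j * e j p f) (e i p) = hdiag r i * a i"
  by (simp add: metric_frame_left[OF frame_tangent] frame_orthonormal
        if_distrib[of "\<lambda>x. _ * x"] mult.commute cong: if_cong)

lemma vector_field_expansion:
  assumes "vector_field A Y"
  obtains y where "\<forall>j. smooth_fun A (y j)" "Y = (\<lambda>p f. \<Sum>j\<in>UNIV. y j p * e j p f)"
proof
  \<comment> \<open>Pairing with \<open>e j\<close> returns the coordinate times
    \<open>hdiag r j\<close>, and \<open>hdiag r j\<close> is its own inverse. Written through the
    metric, the coordinates are visibly smooth.\<close>
  let ?y = "\<lambda>j p. hdiag r j * g p (Y p) (e j p)"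
  show "\<forall>j. smooth_fun A (?y j)"
    by (intro allI smooth_fun_scale metric_smooth assms frame_vector_field)
  show "Y = (\<lambda>p f. \<Sum>j\<in>UNIV. ?y j p * e j p f)"
  proof
    fix p
    obtain c :: "real^3" where c: "Y p = (\<lambda>f. \<Sum>j\<in>UNIV. c $ j * e j p f)"
      using frame_expansion[OF vector_field_tangent[OF assms]] .
    have "?y j p = c $ j" for j
      unfolding c metric_frame_right by (simp add: hdiag_def flip: power_mult_distrib)
    then show "Y p = (\<lambda>f. \<Sum>j\<in>UNIV. ?y j p * e j p f)"
      using c by simp
  qed
qed

text \<open>The \<open>e l\<close> component of the bracket of X with \<open>e i\<close>, where X
  has the frame coefficients \<open>a\<close>.\<close>

definition bracket_coeff :: "(3 \<Rightarrow> 'm \<Rightarrow> real) \<Rightarrow> 'm \<Rightarrow> 3 \<Rightarrow> 3 \<Rightarrow> real" where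
  "bracket_coeff a p i l = (\<Sum>j\<in>UNIV. a j p * frame_structure r H j i l) - e i p (a l)"

lemma lie_bracket_frame_coeff:
  assumes "\<And>j. smooth_fun A (a j)"
  shows "lie_bracket (\<lambda>p f. \<Sum>j\<in>UNIV. a j p * e j p f) (e i) p =
    (\<lambda>f. \<Sum>l\<in>UNIV. bracket_coeff a p i l * e l p f)"
proof
  fix f
  let ?X = "\<lambda>p f. \<Sum>j\<in>UNIV. a j p * e j p f"
  have "lie_bracket (e i) (e j) p f = - lie_bracket (e j) (e i) p f" for j
    by (simp add: lie_bracket_def)
  then have br: "lie_bracket (e i) (e j) p f = - (\<Sum>l\<in>UNIV. frame_structure r H j i l * e l p f)" for j
    by (simp only: lie_bracket_frame)
  \<comment> \<open>Antisymmetry moves the variable coefficients into the second slot, where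
    \<open>lie_bracket_sum\<close> applies.\<close>
  have "lie_bracket ?X (e i) p f = - lie_bracket (e i) ?X p f"
    by (simp add: lie_bracket_def)
  also have "\<dots> = - (\<Sum>j\<in>UNIV. e i p (a j) * e j p f
      + a j p * - (\<Sum>l\<in>UNIV. frame_structure r H j i l * e l p f))"
    using assms by (subst lie_bracket_sum) (auto simp: br frame_vector_field)
  also have "\<dots> = (\<Sum>l\<in>UNIV. bracket_coeff a p i l * e l p f)"
    by (simp add: bracket_coeff_def sum_3 algebra_simps)
  finally show "lie_bracket ?X (e i) p f = (\<Sum>l\<in>UNIV. bracket_coeff a p i l * e l p f)" .
qed

text \<open>The Lie derivative of the metric is tensorial in its two arguments, so it vanishes as
  soon as it vanishes on pairs of frame members. There the metric components are constant and only
  bracket terms remain.\<close>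

lemma killing_field_frame_iff:
  assumes a: "\<And>j. smooth_fun A (a j)"
  shows "killing_field A g (\<lambda>p f. \<Sum>j\<in>UNIV. a j p * e j p f) \<longleftrightarrow>
    (\<forall>p i k. hdiag r k * bracket_coeff a p i k + hdiag r i * bracket_coeff a p k i = 0)"
    (is "killing_field A g ?X \<longleftrightarrow> ?R")
proof
  have X: "vector_field A ?X"
    by (intro vector_field_sum a frame_vector_field)
  note Xp = vector_field_tangent[OF X]
  have frame_sum: "(\<lambda>f. \<Sum>j\<in>UNIV. c j * e j p f) \<in> tangent_space A p" for c p
    by (intro tangent_space_sum frame_tangent)
  {
    assume kill: "killing_field A g ?X"
    show ?R
    proof (intro allI)
      fix p i k
      have "0 = ?X p (\<lambda>q. g q (e i q) (e k q))"
        unfolding frame_orthonormal by (simp only: tangent_const[OF Xp])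
      also have "\<dots> = g p (lie_bracket ?X (e i) p) (e k p) + g p (e i p) (lie_bracket ?X (e k) p)"
        using kill frame_vector_field unfolding killing_field_def by blast
      also have "g p (e i p) (lie_bracket ?X (e k) p) = g p (lie_bracket ?X (e k) p) (e i p)"
        unfolding lie_bracket_frame_coeff[OF a] by (rule metric_sym[OF frame_tangent frame_sum])
      finally show "hdiag r k * bracket_coeff a p i k + hdiag r i * bracket_coeff a p k i = 0"
        unfolding lie_bracket_frame_coeff[OF a] metric_frame_right by (rule sym)
    qed
  }
  assume R: ?R
  show "killing_field A g ?X"
    unfolding killing_field_def
  proof (intro conjI X allI impI)
    fix Y Z p
    assume "vector_field A Y \<and> vector_field A Z"
    then have YZ: "vector_field A Y" "vector_field A Z"
      by auto
    obtain y where y: "\<forall>j. smooth_fun A (y j)" and Y: "Y = (\<lambda>p f. \<Sum>j\<in>UNIV. y j p * e j p f)"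
      using vector_field_expansion[OF YZ(1)] .
    obtain z where z: "\<forall>j. smooth_fun A (z j)" and Z: "Z = (\<lambda>p f. \<Sum>j\<in>UNIV. z j p * e j p f)"
      using vector_field_expansion[OF YZ(2)] .
    note y = y[rule_format] and z = z[rule_format]
    let ?b = "bracket_coeff a p"
    \<comment> \<open>The derivatives of the coefficients will reproduce the product rule for the
      function \<open>g(Y, Z)\<close>; the other part is linear in the coefficients.\<close>
    have bracket: "lie_bracket ?X (\<lambda>p f. \<Sum>j\<in>UNIV. y j p * e j p f) p =
        (\<lambda>f. \<Sum>l\<in>UNIV. (?X p (y l) + (\<Sum>j\<in>UNIV. y j p * ?b j l)) * e l p f)"
      if "\<And>j. smooth_fun A (y j)" for y
    proof
      fix f
      have "lie_bracket ?X (\<lambda>p f. \<Sum>j\<in>UNIV. y j p * e j p f) p f =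
          (\<Sum>j\<in>UNIV. ?X p (y j) * e j p f + y j p * (\<Sum>l\<in>UNIV. ?b j l * e l p f))"
        using that
        by (subst lie_bracket_sum[OF X]) (auto simp: lie_bracket_frame_coeff[OF a] frame_vector_field)
      also have "\<dots> = (\<Sum>l\<in>UNIV. (?X p (y l) + (\<Sum>j\<in>UNIV. y j p * ?b j l)) * e l p f)"
        unfolding sum_3 by (simp only: algebra_simps)
      finally show "lie_bracket ?X (\<lambda>p f. \<Sum>j\<in>UNIV. y j p * e j p f) p f =
        (\<Sum>l\<in>UNIV. (?X p (y l) + (\<Sum>j\<in>UNIV. y j p * ?b j l)) * e l p f)" .
    qed
    have "?X p (\<lambda>q. g q (Y q) (Z q)) = ?X p (\<lambda>q. \<Sum>j\<in>UNIV. hdiag r j * (y j q * z j q))"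
      unfolding Y Z metric_frame by (simp only: mult.assoc)
    also have "\<dots> = (\<Sum>j\<in>UNIV. hdiag r j * ?X p (\<lambda>q. y j q * z j q))"
      by (subst tangent_sum[OF Xp])
        (simp_all only: tangent_scale[OF Xp] smooth_fun_scale smooth_fun_mult y z)
    also have "\<dots> = (\<Sum>j\<in>UNIV. hdiag r j * (y j p * ?X p (z j) + z j p * ?X p (y j)))"
      by (simp only: tangent_mult[OF Xp] y z)
    finally have L: "?X p (\<lambda>q. g q (Y q) (Z q)) =
        (\<Sum>j\<in>UNIV. hdiag r j * (y j p * ?X p (z j) + z j p * ?X p (y j)))" .
    \<comment> \<open>After exchanging the indices in the second sum, the terms without derivatives
      contract the Killing equation of the frame with the coefficients of Y and Z.\<close>
    have "(\<Sum>l\<in>UNIV. hdiag r l * (\<Sum>j\<in>UNIV. y j p * ?b j l) * z l p)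
        + (\<Sum>l\<in>UNIV. hdiag r l * y l p * (\<Sum>j\<in>UNIV. z j p * ?b j l))
        = (\<Sum>j\<in>UNIV. \<Sum>l\<in>UNIV. y j p * z l p * (hdiag r l * ?b j l + hdiag r j * ?b l j))"
      unfolding sum_3 by (simp only: algebra_simps)
    also have "\<dots> = 0"
      using R by simp
    finally have "g p (lie_bracket ?X Y p) (Z p) + g p (Y p) (lie_bracket ?X Z p) =
        (\<Sum>j\<in>UNIV. hdiag r j * (y j p * ?X p (z j) + z j p * ?X p (y j)))"
      unfolding Y Z bracket[OF y] bracket[OF z] metric_frame
      by (simp add: ring_distribs sum.distrib ac_simps)
    then show "?X p (\<lambda>q. g q (Y q) (Z q)) =
        g p (lie_bracket ?X Y p) (Z p) + g p (Y p) (lie_bracket ?X Z p)"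
      using L by simp
  qed
qed

end

text \<open>The library has this only for subsets of normed spaces.\<close>

lemma simply_connected_imp_connected_space:
  fixes S :: "'a::topological_space set"
  assumes "simply_connected S"
  shows "connected S"
proof (rule path_connected_imp_connected, unfold path_connected_def, intro ballI)
  fix a b
  assume ab: "a \<in> S" "b \<in> S"
  have const: "path (\<lambda>_. c) \<and> pathfinish (\<lambda>_. c) = pathstart (\<lambda>_. c) \<and> path_image (\<lambda>_. c) \<subseteq> S"
    if "c \<in> S" for c
    using that by (auto simp: path_def pathstart_def pathfinish_def path_image_def)
  \<comment> \<open>The constant loops at \<open>a\<close> and \<open>b\<close> are freely
    homotopic; following loop parameter 0 through the homotopy gives a path from \<open>a\<close> to
    \<open>b\<close>.\<close>
  then have "homotopic_loops S (\<lambda>_. a) (\<lambda>_. b)"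
    using assms ab unfolding simply_connected_def by blast
  then obtain h where h: "continuous_on ({0..1::real} \<times> {0..1::real}) h"
      "h ` ({0..1} \<times> {0..1}) \<subseteq> S" "\<forall>x\<in>{0..1}. h (0, x) = a" "\<forall>x\<in>{0..1}. h (1, x) = b"
    unfolding homotopic_loops by (auto simp: image_subset_iff_funcset)
  have "continuous_on {0..1} (h \<circ> (\<lambda>t. (t, 0)))"
    by (intro continuous_on_compose continuous_on_subset[OF h(1)] continuous_intros) auto
  with h(2-4) show "\<exists>\<gamma>. path \<gamma> \<and> path_image \<gamma> \<subseteq> S \<and> pathstart \<gamma> = a \<and> pathfinish \<gamma> = b"
    by (intro exI[of _ "h \<circ> (\<lambda>t. (t, 0))"])
      (auto simp: path_def path_image_def pathstart_def pathfinish_def)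
qed

section \<open>Spinors and the Dirac current in dimension three\<close>

lemma mat_scale_mult_vec: "mat_scale c M *v x = c *s (M *v x)"
  by (simp add: mat_scale_def matrix_vector_mult_def vec_eq_iff sum_2 algebra_simps)

lemma mat_scale_simps [simp]: "mat_scale 0 M = 0" "mat_scale 1 M = M"
  by (simp_all add: mat_scale_def vec_eq_iff)

lemma gam_mult_vec:
  "(gam 0 1 *v u) = vector [\<i> * u $ 2, \<i> * u $ 1]"
  "(gam 0 2 *v u) = vector [u $ 2, - (u $ 1)]"
  "(gam 0 3 *v u) = vector [\<i> * u $ 1, - \<i> * u $ 2]"
  "(gam (Suc 0) 1 *v u) = vector [u $ 2, u $ 1]"
  "(gam (Suc 0) 2 *v u) = vector [u $ 2, - (u $ 1)]"
  "(gam (Suc 0) 3 *v u) = vector [\<i> * u $ 1, - \<i> * u $ 2]"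
  by (simp_all add: gam_def pauli_def mat_scale_def matrix_vector_mult_def sum_2 vec_eq_iff
      forall_2 power_int_minus)

text \<open>Squares are spelled out as products so that the Leibniz rule for derivations and
  \<open>smooth_fun_mult\<close> apply directly; \<open>Suc 0\<close> is the form in which the
  simplifier presents the Lorentzian case.\<close>

lemma Re_dirac_coeff:
  "Re (dirac_coeff 0 1 u) = - 2 * (Re (u $ 1) * Re (u $ 2) + Im (u $ 1) * Im (u $ 2))"
  "Re (dirac_coeff 0 2 u) = - 2 * (Re (u $ 1) * Im (u $ 2) - Im (u $ 1) * Re (u $ 2))"
  "Re (dirac_coeff 0 3 u) =
    - (Re (u $ 1) * Re (u $ 1) + Im (u $ 1) * Im (u $ 1)
      - (Re (u $ 2) * Re (u $ 2) + Im (u $ 2) * Im (u $ 2)))"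
  "Re (dirac_coeff (Suc 0) 1 u) =
    - (Re (u $ 1) * Re (u $ 1) + Im (u $ 1) * Im (u $ 1)
      + (Re (u $ 2) * Re (u $ 2) + Im (u $ 2) * Im (u $ 2)))"
  "Re (dirac_coeff (Suc 0) 2 u) =
    - (Re (u $ 1) * Re (u $ 1) + Im (u $ 1) * Im (u $ 1)
      - (Re (u $ 2) * Re (u $ 2) + Im (u $ 2) * Im (u $ 2)))"
  "Re (dirac_coeff (Suc 0) 3 u) = 2 * (Re (u $ 1) * Im (u $ 2) - Im (u $ 1) * Re (u $ 2))"
  by (simp_all add: dirac_coeff_def spin_form_def gam_up_def hdiag_def mat_scale_mult_vec
      gam_mult_vec sum_2 power_int_minus algebra_simps)

text \<open>\<open>gam r 1\<close> is the phase \<open>(-\<i>) powi (int r - 1)\<close> times the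
  swap of the two components, and the phase cancels.\<close>

lemma gam_1_eigen_iff:
  assumes "r \<in> {0, 1}"
  shows "gam r 1 *v u = (s * (-\<i>) powi (int r - 1)) *s u \<longleftrightarrow>
    u $ 2 = s * u $ 1 \<and> u $ 1 = s * u $ 2"
  using assms by (auto simp: gam_mult_vec vec_eq_iff forall_2 power_int_minus)

text \<open>Up to order and nonzero factors, in both signatures the two coefficients are the
  difference of the squared moduli of the components of \<open>u\<close> and the imaginary part of
  their Hermitian product. If both vanish, the components have equal length and are real-parallel,
  hence agree up to sign.\<close>

lemma dirac_coeff_23_zero_iff_eigen:
  assumes "r \<in> {0, 1}"
  shows "Re (dirac_coeff r 2 u) = 0 \<and> Re (dirac_coeff r 3 u) = 0 \<longleftrightarrow>
    (\<exists>s\<in>{1, -1}. gam r 1 *v u = (s * (-\<i>) powi (int r - 1)) *s u)"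
proof -
  define x y x' y' where "x = Re (u $ 1)" "y = Im (u $ 1)" "x' = Re (u $ 2)" "y' = Im (u $ 2)"
  note defs = this
  have "Re (dirac_coeff r 2 u) = 0 \<and> Re (dirac_coeff r 3 u) = 0 \<longleftrightarrow>
      x * y' - y * x' = 0 \<and> x * x + y * y = x' * x' + y' * y'"
    using assms by (auto simp: Re_dirac_coeff defs)
  also have "\<dots> \<longleftrightarrow> u $ 2 = u $ 1 \<or> u $ 2 = - (u $ 1)"
  proof
    assume *: "x * y' - y * x' = 0 \<and> x * x + y * y = x' * x' + y' * y'"
    let ?c = "x * x' + y * y'" and ?n = "x * x + y * y"
    \<comment> \<open>Lagrange's identity for the two components viewed as vectors in the
      plane.\<close>
    have "?c\<^sup>2 + (x * y' - y * x')\<^sup>2 = ?n * (x' * x' + y' * y')"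
      by (simp add: power2_eq_square algebra_simps)
    then have "?c\<^sup>2 = ?n\<^sup>2"
      using * by (simp add: power2_eq_square)
    then consider "?c = ?n" | "?c = - ?n"
      by (auto simp: power2_eq_iff)
    then show "u $ 2 = u $ 1 \<or> u $ 2 = - (u $ 1)"
    proof cases
      case 1
      have "(x - x')\<^sup>2 + (y - y')\<^sup>2 = ?n + (x' * x' + y' * y') - 2 * ?c"
        by (simp add: power2_eq_square algebra_simps)
      then have "(x - x')\<^sup>2 + (y - y')\<^sup>2 = 0"
        using * 1 by simp
      then show ?thesis
        by (auto simp: sum_power2_eq_zero_iff complex_eq_iff defs)
    next
      case 2
      have "(x + x')\<^sup>2 + (y + y')\<^sup>2 = ?n + (x' * x' + y' * y') + 2 * ?c"
        by (simp add: power2_eq_square algebra_simps)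
      then have "(x + x')\<^sup>2 + (y + y')\<^sup>2 = 0"
        using * 2 by simp
      then show ?thesis
        by (auto simp: sum_power2_eq_zero_iff complex_eq_iff defs)
    qed
  qed (auto simp: defs)
  also have "\<dots> \<longleftrightarrow> (\<exists>s\<in>{1, -1}. gam r 1 *v u = (s * (-\<i>) powi (int r - 1)) *s u)"
    unfolding gam_1_eigen_iff[OF assms] by auto
  finally show ?thesis .
qed

text \<open>Once the components agree up to sign, coefficient 1 is, up to sign, twice the squared
  modulus of \<open>u $ 1\<close>.\<close>

lemma dirac_coeff_zero_imp_zero:
  assumes r: "r \<in> {0, 1}" and J: "\<And>j. Re (dirac_coeff r j u) = 0"
  shows "u = 0"
proof -
  have "u $ 2 = u $ 1 \<or> u $ 2 = - (u $ 1)"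
    using dirac_coeff_23_zero_iff_eigen[OF r, of u] J by (auto simp: gam_1_eigen_iff[OF r])
  moreover have "Re (dirac_coeff r 1 u) = 0"
    by (rule J)
  ultimately have "Re (u $ 1) * Re (u $ 1) + Im (u $ 1) * Im (u $ 1) = 0"
    using r by (auto simp: Re_dirac_coeff simp del: sum_squares_eq_zero_iff; linarith)
  then have "u $ 1 = 0"
    by (simp add: complex_eq_iff)
  then show ?thesis
    using \<open>u $ 2 = u $ 1 \<or> u $ 2 = - (u $ 1)\<close> by (auto simp: vec_eq_iff forall_2)
qed

section \<open>SqK-spinors and their Dirac currents in a Sasakian frame\<close>

locale SqK = sasakian_metric_frame A r \<xi> g H e
  for A :: "('m::{t2_space, second_countable_topology}, real^3) chart set" and r \<xi> g H e +
  fixes \<eta> :: "'m oneform" and a b :: real and \<psi> :: "'m spinor"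
  assumes r01: "r \<in> {0, 1}"
    and contact_frame: "\<eta> p (e j p) = (if j = 1 then 1 else 0)"
    and SqK: "SqK_spinor A r \<xi> \<eta> H e a b \<psi>"
begin

text \<open>These are what remains of \<open>a\<close> and \<open>b\<close> after
  \<open>omega_S\<close> is moved to the right-hand side, using that \<open>(-\<i>) ^ r\<close>
  equals \<open>(-1) ^ r * \<i> ^ r\<close>.\<close>

definition \<alpha> :: real where "\<alpha> = a - (-1) ^ r / 2"
definition \<beta> :: real where "\<beta> = b - (H - (-1) ^ r) / 4"

lemma spinor_smooth: "smooth_fun A (\<lambda>p. Re (\<psi> p $ k))" "smooth_fun A (\<lambda>p. Im (\<psi> p $ k))"
  using SqK by (auto simp: SqK_spinor_def spinor_field_def)

lemma coframe_sum:
  "(\<Sum>k\<in>UNIV. mat_scale (of_real (coframe e k p (e j p))) (gam r k)) = gam r j"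
proof -
  have "(\<Sum>k\<in>UNIV. mat_scale (of_real (coframe e k p (e j p))) (gam r k))
      = (\<Sum>k\<in>UNIV. if k = j then gam r k else 0)"
    by (intro sum.cong) (auto simp: coframe_frame)
  then show ?thesis
    by simp
qed

lemma clifford_frame: "clifford r e (e j) \<psi> p = gam r j *v \<psi> p"
  unfolding clifford_def coframe_sum ..

lemma spinor_deriv_frame:
  "spinor_deriv (e j) \<psi> p =
    (\<i> ^ r * of_real (\<alpha> + (if j = 1 then \<beta> else 0))) *s (gam r j *v \<psi> p)"
proof -
  have "spinor_deriv (e j) \<psi> p + omega_S r H e (e j) p *v \<psi> p =
      (of_real a * \<i> ^ r) *s (gam r j *v \<psi> p) +
      (of_real b * \<i> ^ r * of_real (\<eta> p (e j p))) *s (gam r 1 *v \<psi> p)"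
    using SqK frame_vector_field[of j] clifford_frame[of _ p]
    unfolding SqK_spinor_def spin_connection_def frame_Reeb[symmetric] by metis
  moreover have "omega_S r H e (e j) p *v \<psi> p =
      ((-\<i>) ^ r / 2) *s (gam r j *v \<psi> p) +
      (\<i> ^ r * of_real ((H + (-1) powi (int r - 1)) / 4) * (if j = 1 then 1 else 0)) *s
        (gam r 1 *v \<psi> p)"
    unfolding omega_S_def coframe_sum
    by (simp add: coframe_frame matrix_vector_mult_add_rdistrib
        mat_scale_mult_vec)
  ultimately show ?thesis
    using r01
    by (auto simp: \<alpha>_def \<beta>_def contact_frame vec_eq_iff power_int_minus algebra_simps)
qed

lemma spinor_frame_derivative:
  "e j p (\<lambda>q. Re (\<psi> q $ k)) =
    Re (((\<i> ^ r * of_real (\<alpha> + (if j = 1 then \<beta> else 0))) *s (gam r j *v \<psi> p)) $ k)"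
  "e j p (\<lambda>q. Im (\<psi> q $ k)) =
    Im (((\<i> ^ r * of_real (\<alpha> + (if j = 1 then \<beta> else 0))) *s (gam r j *v \<psi> p)) $ k)"
  unfolding spinor_deriv_frame[symmetric] by (simp_all add: spinor_deriv_def)

abbreviation J :: "3 \<Rightarrow> 'm \<Rightarrow> real" where
  "J j p \<equiv> Re (dirac_coeff r j (\<psi> p))"

lemma dirac_smooth: "smooth_fun A (J j)"
  using r01 exhaust_3[of j]
  by (auto simp only: Re_dirac_coeff insert_iff empty_iff One_nat_def
      intro!: smooth_intros spinor_smooth)

text \<open>The first two combinations are the symmetrised derivatives in the (1,2) and (1,3)
  components of the Killing equation, the factor \<open>(-1) ^ r\<close> lowering the index 1. The
  contributions of \<alpha> are skew and cancel there; the third identity isolates \<alpha>.\<close>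

lemma dirac_derivative:
  shows "e 1 p (J 2) + (-1) ^ r * e 2 p (J 1) = 2 * \<beta> * J 3 p"
    and "e 1 p (J 3) + (-1) ^ r * e 3 p (J 1) = - 2 * \<beta> * J 2 p"
    and "e 2 p (J 3) = 2 * \<alpha> * J 1 p"
proof -
  note derivs = tangent_diff[OF frame_tangent] tangent_add[OF frame_tangent]
    tangent_mult[OF frame_tangent] tangent_minus[OF frame_tangent] tangent_const[OF frame_tangent]
    spinor_smooth smooth_intros spinor_frame_derivative
  show "e 1 p (J 2) + (-1) ^ r * e 2 p (J 1) = 2 * \<beta> * J 3 p"
    "e 1 p (J 3) + (-1) ^ r * e 3 p (J 1) = - 2 * \<beta> * J 2 p"
    "e 2 p (J 3) = 2 * \<alpha> * J 1 p"
    using r01 by (auto simp: Re_dirac_coeff derivs gam_mult_vec algebra_simps)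
qed

lemma dirac_current_eq: "dirac_current r e \<psi> = (\<lambda>p f. \<Sum>j\<in>UNIV. J j p * e j p f)"
  by (simp add: dirac_current_def)

lemma killing_imp_horizontal_zero:
  assumes kill: "killing_field A g (dirac_current r e \<psi>)" and b: "b \<noteq> 0"
  shows "J 2 p = 0 \<and> J 3 p = 0"
proof -
  have K: "hdiag r k * bracket_coeff J p i k + hdiag r i * bracket_coeff J p k i = 0" for i k
    using kill unfolding dirac_current_eq killing_field_frame_iff[OF dirac_smooth] by blast
  define k where "k = (H + (-1) ^ r * 3) / 2"
  \<comment> \<open>The structure constants cancel against the connection part of \<beta>, leaving
    only \<open>b\<close>.\<close>
  have k: "k - 2 * (-1) ^ r + 2 * \<beta> = 2 * b"
    by (simp add: k_def \<beta>_def field_simps)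
  \<comment> \<open>The (1,2) component of the Killing equation.\<close>
  have "- k * J 3 p - e 1 p (J 2) + (-1) ^ r * (2 * J 3 p - e 2 p (J 1)) = 0"
    using K[of 2 1]
    by (simp add: bracket_coeff_def sum_3 frame_structure_def hdiag_def Let_def k_def mult.commute)
  then have "(k - 2 * (-1) ^ r + 2 * \<beta>) * J 3 p = 0"
    using dirac_derivative(1)[of p] by (simp add: algebra_simps)
  then have J3: "b * J 3 p = 0"
    unfolding k by simp
  \<comment> \<open>The (1,3) component of the Killing equation.\<close>
  have "k * J 2 p - e 1 p (J 3) + (-1) ^ r * (- 2 * J 2 p - e 3 p (J 1)) = 0"
    using K[of 3 1]
    by (simp add: bracket_coeff_def sum_3 frame_structure_def hdiag_def Let_def k_def mult.commute)
  then have "(k - 2 * (-1) ^ r + 2 * \<beta>) * J 2 p = 0"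
    using dirac_derivative(2)[of p] by (simp add: algebra_simps)
  then have "b * J 2 p = 0"
    unfolding k by simp
  with J3 b show ?thesis
    by simp
qed

lemma horizontal_zero_imp_parameters:
  assumes J23: "\<And>p. J 2 p = 0 \<and> J 3 p = 0" and p: "\<psi> p \<noteq> 0"
  shows "\<alpha> = 0" "\<beta> = 0"
proof -
  have "J 1 p \<noteq> 0"
    using dirac_coeff_zero_imp_zero[OF r01, of "\<psi> p"] J23 p by (metis exhaust_3)
  moreover have "2 * \<alpha> * J 1 p = 0"
    unfolding dirac_derivative(3)[symmetric] using J23 tangent_const[OF frame_tangent] by simp
  ultimately show \<alpha>: "\<alpha> = 0"
    by simp
  \<comment> \<open>The frame is bracket-generating: a function killed everywhere by
    \<open>e 2\<close> and \<open>e 3\<close> is killed by their bracket, a nonzero multiple of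
    \<open>e 1\<close>. With \<alpha> zero this applies to the spinor components.\<close>
  have "e 1 p f = 0" if "\<And>q. e 2 q f = 0" "\<And>q. e 3 q f = 0" for f
  proof -
    have "lie_bracket (e 2) (e 3) p f = 0"
      unfolding lie_bracket_def that by (simp add: tangent_const[OF frame_tangent])
    then show ?thesis
      by (simp add: lie_bracket_frame sum_3 frame_structure_def Let_def)
  qed
  moreover have "e i q (\<lambda>q. Re (\<psi> q $ k)) = 0" "e i q (\<lambda>q. Im (\<psi> q $ k)) = 0"
    if "i \<noteq> 1" for i q k
    using that by (simp_all add: spinor_frame_derivative \<alpha>)
  ultimately have "e 1 p (\<lambda>q. Re (\<psi> q $ k)) = 0 \<and> e 1 p (\<lambda>q. Im (\<psi> q $ k)) = 0" for k
    by simp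
  then have "spinor_deriv (e 1) \<psi> p = 0"
    by (simp add: spinor_deriv_def vec_eq_iff complex_eq_iff)
  then have "of_real \<beta> * (gam r 1 *v \<psi> p) $ k = 0" for k
    unfolding spinor_deriv_frame by (auto simp: \<alpha> vec_eq_iff)
  \<comment> \<open>\<open>gam r 1\<close> only swaps the components up to a unit factor, so it can
    be stripped off.\<close>
  then have "of_real \<beta> * \<psi> p $ k = 0" for k
    using r01 exhaust_2[of k] by (force simp: gam_mult_vec forall_2)
  then show "\<beta> = 0"
    using p by (auto simp: vec_eq_iff)
qed

lemma spinor_constant:
  assumes "\<alpha> = 0" "\<beta> = 0" "connected (UNIV :: 'm set)"
  shows "\<psi> p = \<psi> q"
proof -
  have "v (\<lambda>q. Re (\<psi> q $ k)) = 0 \<and> v (\<lambda>q. Im (\<psi> q $ k)) = 0" if "v \<in> tangent_space A p" for v p k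
    by (rule frame_expansion[OF that]) (simp add: spinor_frame_derivative assms cong: if_cong)
  then have "Re (\<psi> p $ k) = Re (\<psi> q $ k) \<and> Im (\<psi> p $ k) = Im (\<psi> q $ k)" for k
    using constant_if_derivations_vanish[OF spinor_smooth(1) _ assms(3)]
      constant_if_derivations_vanish[OF spinor_smooth(2) _ assms(3)] by blast
  then show ?thesis
    by (simp add: vec_eq_iff complex_eq_iff)
qed

text \<open>With constant coefficients only the bracket with \<open>e 1\<close> survives. It acts as
  an infinitesimal rotation of the plane of \<open>e 2\<close> and \<open>e 3\<close>, where the
  metric is the standard one, so the Killing sum cancels.\<close>

lemma Reeb_killing: "killing_field A g (vf_scale (\<lambda>_. c) \<xi>)"
proof -
  let ?a = "\<lambda>(j::3) (p::'m). if j = 1 then c else 0"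
  have smooth: "smooth_fun A (?a j)" for j
    by (rule smooth_fun_const)
  have "e i p (?a l) = 0" for i p l
    by (rule tangent_const[OF frame_tangent])
  then have "bracket_coeff ?a p i l = c * frame_structure r H 1 i l" for p i l
    by (simp add: bracket_coeff_def sum_3)
  then have "hdiag r k * bracket_coeff ?a p i k + hdiag r i * bracket_coeff ?a p k i = 0" for p i k
    using exhaust_3[of i] exhaust_3[of k] by (auto simp: frame_structure_def Let_def hdiag_def)
  then have "killing_field A g (\<lambda>p f. \<Sum>j\<in>UNIV. ?a j p * e j p f)"
    unfolding killing_field_frame_iff[OF smooth] by blast
  then show ?thesis
    by (simp add: sum_3 vf_scale_def frame_Reeb)
qed

end

section \<open>From the space-form to the frame setting, and the equivalence\<close>

lemma sasakian_metric_contact: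
  assumes atlas: "smooth_atlas A" and r: "r \<in> {0, 1}" and sas: "sasakian A r \<phi> \<xi> \<eta> g"
  shows "symmetric_bilinear_field A g"
    and "u \<in> tangent_space A p \<Longrightarrow> \<eta> p u = (-1) ^ r * g p u (\<xi> p)"
proof -
  interpret smooth_manifold A
    by unfold_locales (rule atlas)
  obtain g' where cm: "contact_metric A \<phi> \<xi> \<eta> g'"
    and g: "\<And>p u v. u \<in> tangent_space A p \<Longrightarrow> v \<in> tangent_space A p \<Longrightarrow>
      g p u v = g' p u v - 2 * real r * \<eta> p u * \<eta> p v"
    using sas unfolding sasakian_def riemannian_sasakian_def by blast
  have \<eta>: "one_form A \<eta>" and g': "symmetric_bilinear_field A g'" and \<xi>: "vector_field A \<xi>"
    and \<eta>\<xi>: "\<And>p. \<eta> p (\<xi> p) = 1"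
    and dual: "\<And>p u. u \<in> tangent_space A p \<Longrightarrow> \<eta> p u = g' p u (\<xi> p)"
    using cm unfolding contact_metric_def contact_form_def riemannian_metric_def by blast+
  have lin: "tv_lin c u d v \<in> tangent_space A p"
    if "u \<in> tangent_space A p" "v \<in> tangent_space A p" for u v c d p
    unfolding tv_lin_def using that by (rule tangent_space_lin)
  show "symmetric_bilinear_field A g"
    unfolding symmetric_bilinear_field_def
  proof (intro conjI allI ballI impI)
    fix p u v
    assume uv: "u \<in> tangent_space A p" "v \<in> tangent_space A p"
    have "g' p u v = g' p v u"
      using g' uv unfolding symmetric_bilinear_field_def by blast
    then show "g p u v = g p v u"
      by (simp add: g[OF uv] g[OF uv(2,1)])
    fix w c d
    assume w: "w \<in> tangent_space A p"
    have "g' p (tv_lin c u d v) w = c * g' p u w + d * g' p v w"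
      using g' uv w unfolding symmetric_bilinear_field_def by blast
    moreover have "\<eta> p (tv_lin c u d v) = c * \<eta> p u + d * \<eta> p v"
      using \<eta> uv unfolding one_form_def by blast
    ultimately show "g p (tv_lin c u d v) w = c * g p u w + d * g p v w"
      unfolding g[OF lin[OF uv] w] g[OF uv(1) w] g[OF uv(2) w] by (simp add: algebra_simps)
  next
    fix X Y
    assume "vector_field A X \<and> vector_field A Y"
    then have XY: "vector_field A X" "vector_field A Y"
      by auto
    have "smooth_fun A (\<lambda>p. g' p (X p) (Y p))"
      using g' XY unfolding symmetric_bilinear_field_def by blast
    moreover have "smooth_fun A (\<lambda>p. \<eta> p (X p))" "smooth_fun A (\<lambda>p. \<eta> p (Y p))"
      using \<eta> XY unfolding one_form_def by blast+
    ultimately have "smooth_fun A (\<lambda>p. g' p (X p) (Y p) - 2 * real r * \<eta> p (X p) * \<eta> p (Y p))"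
      by (intro smooth_fun_diff smooth_fun_mult smooth_fun_const)
    then show "smooth_fun A (\<lambda>p. g p (X p) (Y p))"
      by (simp only: g[OF vector_field_tangent[OF XY(1)] vector_field_tangent[OF XY(2)]])
  qed
  show "\<eta> p u = (-1) ^ r * g p u (\<xi> p)" if "u \<in> tangent_space A p"
    \<comment> \<open>Evaluating the modified metric at the Reeb field gives the factor
      \<open>1 - 2 * real r\<close>, which is \<open>(-1) ^ r\<close> for both admissible
      \<open>r\<close> and is its own inverse.\<close>
    using r dual[OF that] g[OF that vector_field_tangent[OF \<xi>]] \<eta>\<xi> by auto
qed

theorem proposition3p3:
  fixes A :: "('m::{t2_space, second_countable_topology}, real^3) chart set"
    and r :: nat and \<phi> :: "'m endo" and \<xi> :: "'m vfield" and \<eta> :: "'m oneform"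
    and g :: "'m bilform" and H :: real and e :: "3 \<Rightarrow> 'm vfield" and \<psi> :: "'m spinor"
  assumes "r \<in> {0, 1}"
    and "sasakian_space_form A r \<phi> \<xi> \<eta> g H"
    and "sasakian_frame A r \<xi> g H e"
    and "\<exists>a b. SqK_spinor A r \<xi> \<eta> H e a b \<psi>"
    and "\<not> killing_spinor A r H e \<psi>"
  shows "(killing_field A g (dirac_current r e \<psi>) \<longleftrightarrow>
            (\<exists>s\<in>{1, -1}. \<forall>p. clifford r e \<xi> \<psi> p = (s * (-\<i>) powi (int r - 1)) *s \<psi> p)) \<and>
         (killing_field A g (dirac_current r e \<psi>) \<longrightarrow>
            \<psi> \<in> S0 A r \<xi> \<eta> H e \<and>
            (\<exists>c::real. dirac_current r e \<psi> = vf_scale (\<lambda>_. c) \<xi>))"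
proof -
  obtain a b where SqK: "SqK_spinor A r \<xi> \<eta> H e a b \<psi>"
    using assms(4) by blast
  note form = assms(2)[unfolded sasakian_space_form_def]
  have atlas: "smooth_atlas A" and sas: "sasakian A r \<phi> \<xi> \<eta> g"
    using form by simp_all
  have conn: "connected (UNIV :: 'm set)"
    by (rule simply_connected_imp_connected_space[OF form[THEN conjunct2, THEN conjunct1]])
  interpret sasakian_metric_frame A r \<xi> g H e
    by unfold_locales (rule atlas assms(3) sasakian_metric_contact(1)[OF atlas assms(1) sas])+
  interpret SqK A r \<xi> g H e \<eta> a b \<psi>
  proof unfold_locales
    show "\<eta> p (e j p) = (if j = 1 then 1 else 0)" for p j
      unfolding sasakian_metric_contact(2)[OF atlas assms(1) sas frame_tangent]
        frame_Reeb[symmetric] frame_orthonormal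
      using assms(1) by (auto simp: hdiag_def)
  qed (rule assms(1) SqK)+
  \<comment> \<open>For \<open>b = 0\<close> the equation is that of a Killing spinor with constant
    \<open>a\<close> times \<open>\<i> ^ r\<close>.\<close>
  have b: "b \<noteq> 0"
  proof
    assume "b = 0"
    then have "killing_spinor A r H e \<psi>"
      using SqK unfolding SqK_spinor_def killing_spinor_def by auto
    with assms(5) show False ..
  qed
  \<comment> \<open>The zero spinor is a Killing spinor with constant 0. The nonzero value found
    here is what allows dividing by J 1 and by a spinor component later.\<close>
  have "\<exists>p. \<psi> p \<noteq> 0"
  proof (rule ccontr)
    assume "\<not> (\<exists>p. \<psi> p \<noteq> 0)"
    then have "\<psi> = (\<lambda>_. 0)"
      by auto
    then have "spin_connection r H e X \<psi> p = 0 *s clifford r e X \<psi> p" if "vector_field A X" for X p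
      by (simp add: spin_connection_def spinor_deriv_def vec_eq_iff complex_eq_iff
          tangent_const[OF vector_field_tangent[OF that]])
    then have "killing_spinor A r H e \<psi>"
      using SqK unfolding SqK_spinor_def killing_spinor_def by blast
    with assms(5) show False ..
  qed
  then obtain p\<^sub>0 where p0: "\<psi> p\<^sub>0 \<noteq> 0" ..
  have clifford_Reeb: "clifford r e \<xi> \<psi> p = gam r 1 *v \<psi> p" for p
    using clifford_frame[of 1 p] by (simp add: frame_Reeb)
  let ?eigen = "\<lambda>s p. gam r 1 *v \<psi> p = (s * (-\<i>) powi (int r - 1)) *s \<psi> p"
  have eigen_iff: "J 2 p = 0 \<and> J 3 p = 0 \<longleftrightarrow> (\<exists>s\<in>{1, -1}. ?eigen s p)" for p
    by (rule dirac_coeff_23_zero_iff_eigen[OF assms(1)])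
  have main: "killing_field A g (dirac_current r e \<psi>) \<and> (\<exists>s\<in>{1, -1}. \<forall>p. ?eigen s p) \<and>
      \<psi> \<in> S0 A r \<xi> \<eta> H e \<and> (\<exists>c::real. dirac_current r e \<psi> = vf_scale (\<lambda>_. c) \<xi>)"
    if J23: "\<And>p. J 2 p = 0 \<and> J 3 p = 0"
  proof -
    note zero = horizontal_zero_imp_parameters[OF J23 p0]
    have const: "\<psi> p = \<psi> p\<^sub>0" for p
      by (rule spinor_constant[OF zero conn])
    define c where "c = J 1 p\<^sub>0"
    have "J 1 p = c" for p
      unfolding c_def const[of p] ..
    then have current: "dirac_current r e \<psi> = vf_scale (\<lambda>_. c) \<xi>"
      by (simp add: dirac_current_eq sum_3 J23 vf_scale_def frame_Reeb)
    have "a = (-1) ^ r / 2" "b = (H - (-1) ^ r) / 4"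
      using zero unfolding \<alpha>_def \<beta>_def by linarith+
    then have "\<psi> \<in> S0 A r \<xi> \<eta> H e"
      using SqK by (simp only: S0_def mem_Collect_eq)
    \<comment> \<open>Pointwise, the sign could depend on the point; constancy of the spinor carries
      the sign chosen at \<open>p\<^sub>0\<close> to all points.\<close>
    moreover obtain s where "s \<in> {1, -1}" "?eigen s p\<^sub>0"
      using eigen_iff[of p\<^sub>0] J23[of p\<^sub>0] by blast
    moreover from this(2) have "?eigen s p" for p
      unfolding const[of p] .
    moreover have "killing_field A g (dirac_current r e \<psi>)"
      unfolding current by (rule Reeb_killing)
    ultimately show ?thesis
      using current by blast
  qed
  show ?thesis
    unfolding clifford_Reeb using main killing_imp_horizontal_zero[OF _ b] eigen_iff by blast
qed

end
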